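(* Let $1\leq n<\omega$, let $\kappa$ be a regular infinite cardinal with $\kappa<\mathfrak{m}_{\sigma\text{-}n\text{-linked}}$, and let $D$ be a preorder with $\kappa<\mathrm{Add}(D)$. Then no neighborhood filter in $\beta\omega\setminus\omega$ is cofinally equivalent to $\kappa\times D$.
   Context: $\beta\omega\setminus\omega$ is the Stone–Čech remainder of the discrete space $\omega$. A neighborhood filter in a space $X$ is a set $\mathrm{Nbhd}(p,X)$ with $p\in X$, consisting of all $U\subseteq X$ such that $p$ is in the interior of $U$, preordered by containment $\supseteq$ (smaller neighborhoods are greater). Preorders $P$ and $Q$ are cofinally equivalent if there is a preorder $R$ such that $P$ and $Q$ are order isomorphic to cofinal subsets of $R$. Products have the coordinatewise order. A preorder $P$ is $\lambda$-directed if every $A\subseteq P$ with $|A|<\lambda$ has an upper bound in $P$; $\mathrm{Add}(P)$ is the least cardinal $\lambda$ for which $P$ is not $\lambda$-directed, if it exists; if $P$ has a maximum, $\mathrm{Add}(P)=\infty$, regarded as greater than every cardinal. For a class $\Gamma$ of forcings, $\mathfrak{m}_\Gamma$ is the least cardinal $\mu$ such that there is a forcing $\mathbb{P}\in\Gamma$ and a family $\mathcal{D}$ of $\mu$-many dense subsets of $\mathbb{P}$ such that no filter of $\mathbb{P}$ meets every member of $\mathcal{D}$. A forcing $\mathbb{P}$ is $\sigma$-$n$-linked if it is a union of countably many subsets, each of which is $n$-linked, meaning that any $n$ of its elements have a common lower bound in $\mathbb{P}$ (so every forcing is $\sigma$-$1$-linked, and $\mathfrak{m}_{\sigma\text{-}1\text{-linked}}=\omega_1$).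 $\mathfrak{m}_{\sigma\text{-}n\text{-linked}}$ is $\mathfrak{m}_\Gamma$ for $\Gamma$ the class of $\sigma$-$n$-linked forcings.
   Formalization: Add(P) is taken as the least λ for which P is not λ⁺-directed (the least size of an unbounded subset), not the least λ for which P is not λ-directed; with the latter the claim fails for n=1, κ=ω, D=Nbhd(p), p a non-P-point. *)

theory Defs
  imports "HOL-Analysis.Analysis"
begin

unbundle cardinal_syntax

section \<open>Preorders, cofinal equivalence and additivity\<close>

text \<open>
  A preorder is a relation \<open>P\<close> with \<^term>\<open>Preorder P\<close>; its underlying set is \<^term>\<open>Field P\<close>, and
  \<open>(x, y) \<in> P\<close> means \<open>x \<le> y\<close>. Cardinals are the well-orders of the library
  (\<^term>\<open>Card_order\<close>), so a cardinal is in particular a preorder in this sense.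
\<close>

definition prod_order :: "'a rel \<Rightarrow> 'b rel \<Rightarrow> ('a \<times> 'b) rel" where
  "prod_order P Q = {((a, b), (a', b')) |a b a' b'. (a, a') \<in> P \<and> (b, b') \<in> Q}"

text \<open>Unlike the library's \<^const>\<open>cofinal\<close>, this does not ask for strictly larger elements.\<close>

definition cofinal_subset :: "'a set \<Rightarrow> 'a rel \<Rightarrow> bool" where
  "cofinal_subset C R \<longleftrightarrow> C \<subseteq> Field R \<and> (\<forall>x\<in>Field R. \<exists>c\<in>C. (x, c) \<in> R)"

definition iso_to_subset :: "('a \<Rightarrow> 'b) \<Rightarrow> 'a rel \<Rightarrow> 'b set \<Rightarrow> 'b rel \<Rightarrow> bool" where
  "iso_to_subset f P C R \<longleftrightarrow>
     bij_betw f (Field P) C \<and> (\<forall>x\<in>Field P. \<forall>y\<in>Field P. (x, y) \<in> P \<longleftrightarrow> (f x, f y) \<in> R)"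

text \<open>
  The ambient preorder \<open>R\<close> may live on any set. As types cannot be quantified inside a formula,
  its type is a parameter; a theorem denying cofinal equivalence is stated for all types.
\<close>

definition cofinally_equivalent :: "'c itself \<Rightarrow> 'a rel \<Rightarrow> 'b rel \<Rightarrow> bool" where
  "cofinally_equivalent (_ :: 'c itself) P Q \<longleftrightarrow>
     (\<exists>R :: 'c rel. Preorder R \<and>
        (\<exists>f C. cofinal_subset C R \<and> iso_to_subset f P C R) \<and>
        (\<exists>g C. cofinal_subset C R \<and> iso_to_subset g Q C R))"

definition card_directed :: "'k rel \<Rightarrow> 'a rel \<Rightarrow> bool" where
  "card_directed \<mu> P \<longleftrightarrow>
     (\<forall>A \<subseteq> Field P. |A| <o \<mu> \<longrightarrow> (\<exists>u\<in>Field P. \<forall>a\<in>A. (a, u) \<in> P))"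

text \<open>The least cardinal, determined up to \<open>=o\<close>, with a property invariant under \<open>=o\<close>.\<close>

definition least_cardinal :: "('a rel \<Rightarrow> bool) \<Rightarrow> 'a rel" where
  "least_cardinal \<Phi> =
     (SOME \<mu>. Card_order \<mu> \<and> \<Phi> \<mu> \<and> (\<forall>\<nu>. Card_order \<nu> \<and> \<Phi> \<nu> \<longrightarrow> \<mu> \<le>o \<nu>))"

text \<open>
  Additivity: \<open>Add P\<close> is the least cardinal \<open>\<mu>\<close> for which \<open>P\<close> is not \<open>\<mu>\<^sup>+\<close>-directed, that is, the
  least size of an unbounded subset; \<^const>\<open>None\<close> stands for \<open>\<infinity>\<close>. If \<open>P\<close> has no maximum, then
  \<^term>\<open>Field P\<close> is unbounded, so \<open>\<mu>\<close> can be sought on the type of \<open>P\<close>.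

  The successor matters. Directedness for \<open>\<mu>\<close> only speaks of sets smaller than \<open>\<mu>\<close>, so the
  least \<open>\<mu>\<close> for which \<open>P\<close> is not \<open>\<mu>\<close>-directed is \<open>\<omega>\<^sub>1\<close> for \<open>P = \<omega>\<close>, whereas the additivity of
  \<open>\<omega>\<close> is \<open>\<omega>\<close>. With that convention, \<open>\<kappa> < Add D\<close> would only say that \<open>D\<close> is \<open>\<kappa>\<close>-directed, which for
  \<open>\<kappa> = \<omega>\<close> holds for the neighborhood filter \<open>D\<close> of every point \<open>p\<close> of \<open>\<beta>\<omega> - \<omega>\<close>. But if \<open>p\<close> is not
  a P-point, choose neighborhoods \<open>A 0 \<supseteq> A 1 \<supseteq> \<dots>\<close> of \<open>p\<close> with \<open>A 0\<close> the whole space whose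
  intersection is not a neighborhood, and let \<open>h U\<close> be the largest \<open>n\<close> with \<open>U \<subseteq> A n\<close>. Then
  \<open>U \<mapsto> (h U, U)\<close> is an isomorphism of \<open>D\<close> with a cofinal subset of \<open>\<omega> \<times> D\<close>.
\<close>

definition Add :: "'a rel \<Rightarrow> 'a rel option" where
  "Add P = (if \<exists>m\<in>Field P. \<forall>x\<in>Field P. (x, m) \<in> P then None
            else Some (least_cardinal (\<lambda>\<mu>. \<not> card_directed (cardSuc \<mu>) P)))"

fun less_infty :: "'k rel \<Rightarrow> 'a rel option \<Rightarrow> bool" (infix \<open><\<infinity>\<close> 50) where
  "\<kappa> <\<infinity> None \<longleftrightarrow> True"
| "\<kappa> <\<infinity> Some \<mu> \<longleftrightarrow> \<kappa> <o \<mu>"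

lemma least_cardinal:
  assumes "Card_order \<mu>" "\<Phi> \<mu>"
  shows "Card_order (least_cardinal \<Phi>)" "\<Phi> (least_cardinal \<Phi>)"
    "\<And>\<nu>. Card_order \<nu> \<Longrightarrow> \<Phi> \<nu> \<Longrightarrow> least_cardinal \<Phi> \<le>o \<nu>"
proof -
  let ?R = "{\<nu>. Card_order \<nu> \<and> \<Phi> \<nu>}"
  have "\<exists>\<mu>\<in>?R. \<forall>\<nu>\<in>?R. \<mu> \<le>o \<nu>"
    using assms by (intro exists_minim_Card_order) auto
  then have "\<exists>\<mu>. Card_order \<mu> \<and> \<Phi> \<mu> \<and> (\<forall>\<nu>. Card_order \<nu> \<and> \<Phi> \<nu> \<longrightarrow> \<mu> \<le>o \<nu>)" by auto
  from someI_ex[OF this, folded least_cardinal_def]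
  show "Card_order (least_cardinal \<Phi>)" "\<Phi> (least_cardinal \<Phi>)"
    "\<And>\<nu>. Card_order \<nu> \<Longrightarrow> \<Phi> \<nu> \<Longrightarrow> least_cardinal \<Phi> \<le>o \<nu>" by auto
qed

lemma less_Add_iff:
  fixes \<kappa> :: "'k rel" and P :: "'a rel"
  assumes \<kappa>: "Card_order \<kappa>"
  shows "\<kappa> <\<infinity> Add P \<longleftrightarrow>
    (\<forall>A \<subseteq> Field P. |A| \<le>o \<kappa> \<longrightarrow> (\<exists>u\<in>Field P. \<forall>a\<in>A. (a, u) \<in> P))"
proof (cases "\<exists>m\<in>Field P. \<forall>x\<in>Field P. (x, m) \<in> P")
  case True
  then show ?thesis by (auto simp: Add_def)
next
  case False
  define \<mu> :: "'a rel" where "\<mu> = least_cardinal (\<lambda>\<mu>. \<not> card_directed (cardSuc \<mu>) P)"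
  have A: "Add P = Some \<mu>" using False by (simp add: Add_def \<mu>_def)
  have unb: "\<not> card_directed (cardSuc |A| ) P"
    if "A \<subseteq> Field P" "\<not> (\<exists>u\<in>Field P. \<forall>a\<in>A. (a, u) \<in> P)" for A
    using that cardSuc_greater[OF card_of_Card_order, of A] unfolding card_directed_def by blast
  have "\<not> card_directed (cardSuc |Field P| ) P" using unb[of "Field P"] False by blast
  note \<mu> = least_cardinal[of "|Field P|" "\<lambda>\<mu>. \<not> card_directed (cardSuc \<mu>) P",
      OF card_of_Card_order this, folded \<mu>_def]
  have wo: "Well_order \<kappa>" "Well_order \<mu>" using \<kappa> \<mu>(1) card_order_on_well_order_on by blast+
  show ?thesis unfolding A less_infty.simps
  proof
    assume less: "\<kappa> <o \<mu>"
    show "\<forall>A \<subseteq> Field P. |A| \<le>o \<kappa> \<longrightarrow> (\<exists>u\<in>Field P. \<forall>a\<in>A. (a, u) \<in> P)"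
    proof (intro allI impI, rule ccontr)
      fix A assume A: "A \<subseteq> Field P" "|A| \<le>o \<kappa>" "\<not> (\<exists>u\<in>Field P. \<forall>a\<in>A. (a, u) \<in> P)"
      have "\<mu> \<le>o |A|" using \<mu>(3)[OF card_of_Card_order unb[OF A(1,3)]] .
      then have "\<mu> \<le>o \<kappa>" using A(2) ordLeq_transitive by blast
      then show False using less not_ordLess_ordLeq by blast
    qed
  next
    assume R: "\<forall>A \<subseteq> Field P. |A| \<le>o \<kappa> \<longrightarrow> (\<exists>u\<in>Field P. \<forall>a\<in>A. (a, u) \<in> P)"
    show "\<kappa> <o \<mu>"
    proof (rule ccontr)
      assume "\<not> \<kappa> <o \<mu>"
      then have le: "\<mu> \<le>o \<kappa>" using wo not_ordLess_iff_ordLeq by blast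
      obtain A where A: "A \<subseteq> Field P" "|A| <o cardSuc \<mu>" "\<not> (\<exists>u\<in>Field P. \<forall>a\<in>A. (a, u) \<in> P)"
        using \<mu>(2) unfolding card_directed_def by blast
      have "|A| \<le>o \<mu>" using A(2) cardSuc_ordLeq_ordLess[OF \<mu>(1) card_of_Card_order] by blast
      then show False using R A(1,3) le ordLeq_transitive by blast
    qed
  qed
qed


section \<open>The space \<open>\<beta>\<omega> - \<omega>\<close> and neighborhood filters\<close>

definition ultrafilter :: "'a filter \<Rightarrow> bool" where
  "ultrafilter F \<longleftrightarrow> F \<noteq> bot \<and> (\<forall>S. eventually S F \<or> eventually (\<lambda>x. \<not> S x) F)"

text \<open>
  \<open>\<beta>\<omega>\<close> is the space of ultrafilters on \<open>\<omega>\<close>, with the sets of all ultrafilters containing a given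
  \<open>A \<subseteq> \<omega>\<close> as a base; \<open>n \<in> \<omega>\<close> is identified with the principal ultrafilter at \<open>n\<close>.
\<close>

definition beta_omega :: "nat filter topology" where
  "beta_omega = topology_generated_by
     (range (\<lambda>A. {F. ultrafilter F \<and> eventually (\<lambda>n. n \<in> A) F}))"

definition omega_star :: "nat filter topology" where
  "omega_star = subtopology beta_omega (- range (\<lambda>n. principal {n}))"

definition nbhds_of :: "'a \<Rightarrow> 'a topology \<Rightarrow> 'a set set" where
  "nbhds_of p X = {U. U \<subseteq> topspace X \<and> p \<in> X interior_of U}"

definition Nbhd :: "'a \<Rightarrow> 'a topology \<Rightarrow> 'a set rel" where
  "Nbhd p X = {(U, V). U \<in> nbhds_of p X \<and> V \<in> nbhds_of p X \<and> U \<supseteq> V}"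

lemma topspace_beta_omega: "topspace beta_omega = Collect ultrafilter"
proof -
  have "eventually (\<lambda>n. n \<in> UNIV) F" for F :: "nat filter" by simp
  then show ?thesis unfolding beta_omega_def topology_generated_by_topspace by blast
qed

lemma Field_Nbhd: "Field (Nbhd p X) = nbhds_of p X"
  by (auto simp: Nbhd_def Field_def)

lemma Preorder_Nbhd: "Preorder (Nbhd p X)"
  unfolding preorder_on_def Field_Nbhd
  by (auto simp: Nbhd_def refl_on_def trans_def)

lemma Field_prod_order:
  assumes "Preorder P" "Preorder Q"
  shows "Field (prod_order P Q) = Field P \<times> Field Q"
  using assms unfolding preorder_on_def refl_on_def
  by (fastforce simp: prod_order_def Field_def)


section \<open>Forcings and the cardinals \<open>\<mm>(\<sigma>-n-linked)\<close>\<close>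

text \<open>In a forcing, smaller conditions are stronger.\<close>

definition forcing :: "'p rel \<Rightarrow> bool" where
  "forcing P \<longleftrightarrow> Preorder P \<and> Field P \<noteq> {}"

definition dense_subset :: "'p rel \<Rightarrow> 'p set \<Rightarrow> bool" where
  "dense_subset P D \<longleftrightarrow> D \<subseteq> Field P \<and> (\<forall>p\<in>Field P. \<exists>d\<in>D. (d, p) \<in> P)"

definition forcing_filter :: "'p rel \<Rightarrow> 'p set \<Rightarrow> bool" where
  "forcing_filter P G \<longleftrightarrow> G \<subseteq> Field P \<and> G \<noteq> {} \<and>
     (\<forall>p\<in>G. \<forall>q. (p, q) \<in> P \<longrightarrow> q \<in> G) \<and>
     (\<forall>p\<in>G. \<forall>q\<in>G. \<exists>r\<in>G. (r, p) \<in> P \<and> (r, q) \<in> P)"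

definition n_linked :: "nat \<Rightarrow> 'p rel \<Rightarrow> 'p set \<Rightarrow> bool" where
  "n_linked n P A \<longleftrightarrow>
     (\<forall>ps. length ps = n \<and> set ps \<subseteq> A \<longrightarrow> (\<exists>q\<in>Field P. \<forall>p\<in>set ps. (q, p) \<in> P))"

definition sigma_n_linked :: "nat \<Rightarrow> 'p rel \<Rightarrow> bool" where
  "sigma_n_linked n P \<longleftrightarrow>
     (\<exists>A :: nat \<Rightarrow> 'p set. Field P = (\<Union>i. A i) \<and> (\<forall>i. n_linked n P (A i)))"

definition unmet_dense_sets :: "'p rel \<Rightarrow> 'p set set \<Rightarrow> bool" where
  "unmet_dense_sets P \<D> \<longleftrightarrow> (\<forall>D\<in>\<D>. dense_subset P D) \<and>
     \<not> (\<exists>G. forcing_filter P G \<and> (\<forall>D\<in>\<D>. G \<inter> D \<noteq> {}))"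

text \<open>
  The definition only looks at forcings on sets of reals and at cardinals \<open>\<mu>\<close> up to the
  continuum. This is no restriction: the theorems \<open>m_sigma_n_linked_attained\<close> and
  \<open>m_sigma_n_linked_least\<close> below characterize the same cardinal with forcings on arbitrary types.
\<close>

definition m_sigma_n_linked :: "nat \<Rightarrow> nat set rel" where
  "m_sigma_n_linked n = least_cardinal (\<lambda>\<mu>. \<exists>(P :: nat set rel) \<D>.
     forcing P \<and> sigma_n_linked n P \<and> |\<D>| =o \<mu> \<and> unmet_dense_sets P \<D>)"


subsection \<open>Independence of the type carrying the forcing\<close>

abbreviation continuum :: "nat set rel" where
  "continuum \<equiv> |UNIV :: nat set set|"

lemma infinite_nat_sets: "infinite (UNIV :: nat set set)"
  by (simp add: Finite_Set.finite_set)

lemma card_of_lists_continuum: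
  assumes "|A| \<le>o continuum"
  shows "|lists A| \<le>o continuum"
proof -
  obtain f :: "'a \<Rightarrow> nat set" where f: "inj_on f A"
    using assms card_of_ordLeq[of A "UNIV :: nat set set"] by auto
  define c :: "'a list \<Rightarrow> nat set" where
    "c xs = {prod_encode (0, length xs)} \<union>
            {prod_encode (Suc i, k) |i k. i < length xs \<and> k \<in> f (xs ! i)}" for xs
  have len: "prod_encode (0, m) \<in> c xs \<longleftrightarrow> m = length xs" for m xs
    by (auto simp: c_def)
  have nth: "prod_encode (Suc i, k) \<in> c xs \<longleftrightarrow> i < length xs \<and> k \<in> f (xs ! i)" for i k xs
    by (auto simp: c_def)
  have "inj_on c (lists A)"
  proof (rule inj_onI)
    fix xs ys assume xs: "xs \<in> lists A" and ys: "ys \<in> lists A" and eq: "c xs = c ys"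
    have l: "length xs = length ys" using len[of "length xs" xs] len[of "length xs" ys] eq by simp
    show "xs = ys"
    proof (rule nth_equalityI[OF l])
      fix i assume i: "i < length xs"
      have "f (xs ! i) = f (ys ! i)" using nth[of i _ xs] nth[of i _ ys] eq i l by auto
      moreover have "xs ! i \<in> A" "ys ! i \<in> A" using xs ys i l by (auto simp: in_lists_conv_set)
      ultimately show "xs ! i = ys ! i" using f by (auto dest: inj_onD)
    qed
  qed
  then show ?thesis using card_of_ordLeq[of "lists A" "UNIV :: nat set set"] by blast
qed

lemma small_closure:
  assumes \<D>: "|\<D>| \<le>o continuum"
  obtains Q where "p0 \<in> Q" "|Q| \<le>o continuum"
    "\<And>D p. D \<in> \<D> \<Longrightarrow> p \<in> Q \<Longrightarrow> e D p \<in> Q"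
    "\<And>ps. set ps \<subseteq> Q \<Longrightarrow> h ps \<in> Q"
proof -
  define L where "L = rec_nat {p0} (\<lambda>_ S. S \<union> (\<Union>D\<in>\<D>. e D ` S) \<union> h ` lists S)"
  have L0: "L 0 = {p0}" and LS: "L (Suc k) = L k \<union> (\<Union>D\<in>\<D>. e D ` L k) \<union> h ` lists (L k)" for k
    by (simp_all add: L_def)
  have inf: "infinite (Field continuum)" by (simp add: Field_card_of infinite_nat_sets)
  have card: "|L k| \<le>o continuum" for k
  proof (induction k)
    case 0
    show ?case unfolding L0
      by (rule card_of_singl_ordLeq) simp
  next
    case (Suc k)
    have "|e D ` L k| \<le>o continuum" for D using card_of_image Suc ordLeq_transitive by blast
    then have "|\<Union>D\<in>\<D>. e D ` L k| \<le>o continuum"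
      by (intro card_of_UNION_ordLeq_infinite infinite_nat_sets \<D>) auto
    moreover have "|h ` lists (L k)| \<le>o continuum"
      using card_of_image card_of_lists_continuum[OF Suc] ordLeq_transitive by blast
    ultimately show ?case unfolding LS
      using Suc inf card_of_Card_order by (metis card_of_Un_ordLeq_infinite_Field)
  qed
  have mono: "L i \<subseteq> L j" if "i \<le> j" for i j
    using that by (rule lift_Suc_mono_le[of L, rotated]) (auto simp: LS)
  have fin: "\<exists>k. set ps \<subseteq> L k" if "set ps \<subseteq> (\<Union>k. L k)" for ps
    using that
  proof (induction ps)
    case (Cons p ps)
    then obtain i j where "p \<in> L i" "set ps \<subseteq> L j" by auto
    then have "set (p # ps) \<subseteq> L (max i j)"
      using mono[of i "max i j"] mono[of j "max i j"] by auto
    then show ?case ..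
  qed auto
  have "|UNIV :: nat set| \<le>o continuum"
    using infinite_nat_sets infinite_iff_card_of_nat by blast
  then have "|\<Union>k. L k| \<le>o continuum"
    using card by (intro card_of_UNION_ordLeq_infinite infinite_nat_sets) auto
  moreover have "p0 \<in> (\<Union>k. L k)" using L0 by auto
  moreover have "e D p \<in> (\<Union>k. L k)" if "D \<in> \<D>" and p: "p \<in> (\<Union>k. L k)" for D p
  proof -
    obtain k where "p \<in> L k" using p by blast
    with that(1) have "e D p \<in> L (Suc k)" unfolding LS by blast
    then show ?thesis by blast
  qed
  moreover have "h ps \<in> (\<Union>k. L k)" if ps: "set ps \<subseteq> (\<Union>k. L k)" for ps
  proof -
    obtain k where "set ps \<subseteq> L k" using fin[OF ps] by blast
    then have "h ps \<in> L (Suc k)" unfolding LS by (auto simp: in_lists_conv_set)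
    then show ?thesis by blast
  qed
  ultimately show thesis using that by blast
qed

lemma forcing_on_nat_sets:
  fixes P :: "'p rel"
  assumes P: "forcing P" and lk: "sigma_n_linked n P" and um: "unmet_dense_sets P \<D>"
    and \<D>: "|\<D>| \<le>o continuum"
  shows "\<exists>(P' :: nat set rel) \<D>'. forcing P' \<and> sigma_n_linked n P' \<and>
           unmet_dense_sets P' \<D>' \<and> |\<D>'| \<le>o |\<D>|"
proof -
  have refl: "(p, p) \<in> P" if "p \<in> Field P" for p
    using P that unfolding forcing_def preorder_on_def refl_on_def by blast
  have tr: "(a, c) \<in> P" if "(a, b) \<in> P" "(b, c) \<in> P" for a b c
    using P that unfolding forcing_def preorder_on_def trans_def by blast
  obtain p0 where p0: "p0 \<in> Field P" using P by (auto simp: forcing_def)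
  have "\<forall>D p. \<exists>d. D \<in> \<D> \<and> p \<in> Field P \<longrightarrow> d \<in> D \<and> (d, p) \<in> P"
    using um by (meson dense_subset_def unmet_dense_sets_def)
  then obtain e where e: "\<And>D p. D \<in> \<D> \<Longrightarrow> p \<in> Field P \<Longrightarrow> e D p \<in> D \<and> (e D p, p) \<in> P"
    by metis
  define h where "h ps = (SOME q. q \<in> Field P \<and> (\<forall>p\<in>set ps. (q, p) \<in> P))" for ps
  have h: "h ps \<in> Field P \<and> (\<forall>p\<in>set ps. (h ps, p) \<in> P)"
    if "\<exists>q\<in>Field P. \<forall>p\<in>set ps. (q, p) \<in> P" for ps
  proof -
    have "\<exists>q. q \<in> Field P \<and> (\<forall>p\<in>set ps. (q, p) \<in> P)" using that by blast
    from someI_ex[OF this] show ?thesis unfolding h_def .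
  qed
  obtain Q0 where Q0: "p0 \<in> Q0" "|Q0| \<le>o continuum"
    "\<And>D p. D \<in> \<D> \<Longrightarrow> p \<in> Q0 \<Longrightarrow> e D p \<in> Q0" "\<And>ps. set ps \<subseteq> Q0 \<Longrightarrow> h ps \<in> Q0"
    using small_closure[OF \<D>, of p0 e h] by blast
  define Q where "Q = Q0 \<inter> Field P"
  have QF: "Q \<subseteq> Field P" and p0Q: "p0 \<in> Q" using p0 Q0 by (auto simp: Q_def)
  have eQ: "e D p \<in> Q \<inter> D \<and> (e D p, p) \<in> P" if "D \<in> \<D>" "p \<in> Q" for D p
    using that Q0(3) e[of D p] by (auto simp: Q_def Field_def)
  have "|Q| \<le>o continuum"
    using Q0(2) card_of_mono1[of Q Q0] ordLeq_transitive unfolding Q_def by blast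
  then obtain j :: "'p \<Rightarrow> nat set" where j: "inj_on j Q"
    using card_of_ordLeq[of Q "UNIV :: nat set set"] by auto
  have jeq: "j a = j b \<longleftrightarrow> a = b" if "a \<in> Q" "b \<in> Q" for a b
    using that j by (auto dest: inj_onD)
  define P' where "P' = {(j a, j b) |a b. a \<in> Q \<and> b \<in> Q \<and> (a, b) \<in> P}"
  define \<D>' where "\<D>' = (\<lambda>D. j ` (D \<inter> Q)) ` \<D>"
  have P'iff: "(j a, j b) \<in> P' \<longleftrightarrow> (a, b) \<in> P" if "a \<in> Q" "b \<in> Q" for a b
  proof
    assume "(j a, j b) \<in> P'"
    then obtain a' b' where *: "j a = j a'" "j b = j b'" "a' \<in> Q" "b' \<in> Q" "(a', b') \<in> P"
      unfolding P'_def by blast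
    then have "a = a'" "b = b'" using that jeq by simp_all
    then show "(a, b) \<in> P" using *(5) by simp
  qed (use that in \<open>auto simp: P'_def\<close>)
  have FP': "Field P' = j ` Q"
  proof
    show "Field P' \<subseteq> j ` Q" by (auto simp: P'_def Field_def)
    show "j ` Q \<subseteq> Field P'"
    proof
      fix x assume "x \<in> j ` Q"
      then obtain a where a: "a \<in> Q" "x = j a" by blast
      then have "(x, x) \<in> P'" using refl QF P'iff by auto
      then show "x \<in> Field P'" by (rule FieldI1)
    qed
  qed
  have "Preorder P'"
    unfolding preorder_on_def
  proof (intro conjI)
    show "P' \<subseteq> Field P' \<times> Field P'" by (auto simp: Field_def)
    show "Refl P'" using refl QF P'iff unfolding refl_on_def FP' by auto
    show "trans P'"
    proof (rule transI)
      fix x y z assume "(x, y) \<in> P'" "(y, z) \<in> P'"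
      then obtain a b b' c where *: "x = j a" "y = j b" "y = j b'" "z = j c"
        "a \<in> Q" "b \<in> Q" "b' \<in> Q" "c \<in> Q" "(a, b) \<in> P" "(b', c) \<in> P"
        unfolding P'_def by blast
      then have "b = b'" using jeq by metis
      then show "(x, z) \<in> P'" using * tr P'iff by metis
    qed
  qed
  then have F: "forcing P'" using p0Q FP' by (auto simp: forcing_def)
  have S: "sigma_n_linked n P'"
  proof -
    obtain A :: "nat \<Rightarrow> 'p set" where A: "Field P = (\<Union>i. A i)" "\<And>i. n_linked n P (A i)"
      using lk unfolding sigma_n_linked_def by blast
    have "n_linked n P' (j ` (A i \<inter> Q))" for i
      unfolding n_linked_def
    proof (intro allI impI)
      fix xs assume xs: "length xs = n \<and> set xs \<subseteq> j ` (A i \<inter> Q)"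
      define ps where "ps = map (inv_into Q j) xs"
      have inv: "inv_into Q j x \<in> A i \<inter> Q" "j (inv_into Q j x) = x" if x: "x \<in> set xs" for x
      proof -
        have "x \<in> j ` (A i \<inter> Q)" using xs x by blast
        then obtain a where a: "a \<in> A i" "a \<in> Q" "x = j a" by blast
        have "inv_into Q j x = a" using a j by simp
        then show "inv_into Q j x \<in> A i \<inter> Q" "j (inv_into Q j x) = x" using a by auto
      qed
      have ps: "length ps = n" "set ps \<subseteq> A i \<inter> Q" using xs inv by (auto simp: ps_def)
      then have "\<exists>q\<in>Field P. \<forall>p\<in>set ps. (q, p) \<in> P"
        using A(2)[of i] unfolding n_linked_def by (metis le_inf_iff)
      from h[OF this] have hp: "h ps \<in> Field P" "\<And>p. p \<in> set ps \<Longrightarrow> (h ps, p) \<in> P" by auto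
      have hQ: "h ps \<in> Q" using Q0(4)[of ps] ps hp by (auto simp: Q_def)
      have "(j (h ps), x) \<in> P'" if "x \<in> set xs" for x
      proof -
        have "(h ps, inv_into Q j x) \<in> P" using hp(2) that by (auto simp: ps_def)
        then show ?thesis using P'iff[OF hQ, of "inv_into Q j x"] inv[OF that] by auto
      qed
      then show "\<exists>q\<in>Field P'. \<forall>p\<in>set xs. (q, p) \<in> P'" using hQ FP' by auto
    qed
    moreover have "Field P' = (\<Union>i. j ` (A i \<inter> Q))"
    proof -
      have "Q = (\<Union>i. A i \<inter> Q)" using A(1) QF by blast
      then show ?thesis unfolding FP' by (metis image_UN)
    qed
    ultimately show ?thesis unfolding sigma_n_linked_def
      by (intro exI[of _ "\<lambda>i. j ` (A i \<inter> Q)"]) auto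
  qed
  have dense: "dense_subset P' D'" if "D' \<in> \<D>'" for D'
  proof -
    obtain D where D: "D \<in> \<D>" "D' = j ` (D \<inter> Q)" using \<open>D' \<in> \<D>'\<close> by (auto simp: \<D>'_def)
    have "\<exists>d\<in>D'. (d, x) \<in> P'" if x: "x \<in> Field P'" for x
    proof -
      obtain p where p: "p \<in> Q" "x = j p" using x unfolding FP' by blast
      then have "j (e D p) \<in> D'" "(j (e D p), x) \<in> P'" using eQ[OF D(1) p(1)] D(2) P'iff by auto
      then show ?thesis by blast
    qed
    then show ?thesis using D FP' unfolding dense_subset_def by auto
  qed
  have nofilter: False if G: "forcing_filter P' G" "\<forall>D'\<in>\<D>'. G \<inter> D' \<noteq> {}" for G
  proof -
    define H where "H = {q. \<exists>p\<in>Q. j p \<in> G \<and> (p, q) \<in> P}"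
    have GQ: "G \<subseteq> j ` Q" "G \<noteq> {}" using G(1) FP' by (auto simp: forcing_filter_def)
    have "forcing_filter P H"
      unfolding forcing_filter_def
    proof (intro conjI ballI allI impI)
      show "H \<subseteq> Field P" by (auto simp: H_def Field_def)
      show "H \<noteq> {}"
      proof -
        obtain p where "p \<in> Q" "j p \<in> G" using GQ by auto
        then have "p \<in> H" using refl QF by (auto simp: H_def)
        then show ?thesis by blast
      qed
      fix a assume a: "a \<in> H"
      show "b \<in> H" if "(a, b) \<in> P" for b using a that tr unfolding H_def by blast
      fix b assume b: "b \<in> H"
      obtain p q where pq: "p \<in> Q" "j p \<in> G" "(p, a) \<in> P" "q \<in> Q" "j q \<in> G" "(q, b) \<in> P"
        using a b unfolding H_def by blast
      then obtain x where x: "x \<in> G" "(x, j p) \<in> P'" "(x, j q) \<in> P'"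
        using G(1) unfolding forcing_filter_def by metis
      then obtain r where r: "r \<in> Q" "x = j r" using GQ by blast
      have "(r, p) \<in> P" "(r, q) \<in> P" using x r pq P'iff by auto
      then have "(r, a) \<in> P" "(r, b) \<in> P" using tr pq by blast+
      moreover have "r \<in> H" using r x refl QF by (auto simp: H_def)
      ultimately show "\<exists>r\<in>H. (r, a) \<in> P \<and> (r, b) \<in> P" by blast
    qed
    moreover have "H \<inter> D \<noteq> {}" if "D \<in> \<D>" for D
    proof -
      have "G \<inter> j ` (D \<inter> Q) \<noteq> {}" using G(2) that by (auto simp: \<D>'_def)
      then obtain d where "d \<in> D" "d \<in> Q" "j d \<in> G" by auto
      then have "d \<in> H" using refl QF by (auto simp: H_def)
      then show ?thesis using \<open>d \<in> D\<close> by blast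
    qed
    ultimately show False using um unfolding unmet_dense_sets_def by blast
  qed
  have "unmet_dense_sets P' \<D>'" using dense nofilter unfolding unmet_dense_sets_def by blast
  moreover have "|\<D>'| \<le>o |\<D>|" unfolding \<D>'_def by (rule card_of_image)
  ultimately show ?thesis using F S by blast
qed

lemma Cohen_forcing:
  shows "\<exists>(P :: bool list rel) \<D>. forcing P \<and> sigma_n_linked n P \<and>
           unmet_dense_sets P \<D> \<and> |\<D>| \<le>o continuum"
proof -
  define P :: "bool list rel" where "P = {(t @ u, t) |t u. True}"
  define E where "E X = {s :: bool list. \<exists>i<length s. s ! i \<noteq> (i \<in> X)}" for X :: "nat set"
  have refl: "(s, s) \<in> P" for s by (auto simp: P_def)
  then have FP: "Field P = UNIV" by (auto simp: Field_def)
  have "forcing P"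
    unfolding forcing_def preorder_on_def FP
    by (auto simp: refl_on_def refl trans_def P_def)
  moreover have "sigma_n_linked n P"
    unfolding sigma_n_linked_def
  proof (intro exI[of _ "\<lambda>i. {from_nat i}"] conjI allI)
    show "Field P = (\<Union>i. {from_nat i})"
    proof -
      have "s \<in> (\<Union>i. {from_nat i})" for s :: "bool list"
        by (rule UN_I[of "to_nat s"]) simp_all
      then show ?thesis unfolding FP by blast
    qed
    show "n_linked n P {from_nat i}" for i
      using refl FP unfolding n_linked_def by blast
  qed
  moreover have "unmet_dense_sets P (range E)"
    unfolding unmet_dense_sets_def
  proof (intro conjI ballI notI)
    fix D assume "D \<in> range E"
    then obtain X where D: "D = E X" by blast
    have "\<exists>d\<in>D. (d, s) \<in> P" for s
    proof
      show "s @ [length s \<notin> X] \<in> D" unfolding D E_def by (auto intro: exI[of _ "length s"])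
      show "(s @ [length s \<notin> X], s) \<in> P" by (auto simp: P_def)
    qed
    then show "dense_subset P D" using FP by (auto simp: dense_subset_def)
  next
    assume "\<exists>G. forcing_filter P G \<and> (\<forall>D\<in>range E. G \<inter> D \<noteq> {})"
    then obtain G where G: "forcing_filter P G" "\<forall>D\<in>range E. G \<inter> D \<noteq> {}" by (elim exE conjE)
    define X where "X = {i. \<exists>s\<in>G. i < length s \<and> s ! i}"
    have "G \<inter> E X \<noteq> {}" using G(2) by (rule bspec) (rule rangeI)
    then obtain s where "s \<in> G" "s \<in> E X" by blast
    then obtain i where s: "s \<in> G" "i < length s" "s ! i \<noteq> (i \<in> X)"
      unfolding E_def by blast
    have "i \<in> X" if "s ! i" using s that unfolding X_def by blast
    then have "\<not> s ! i" "i \<in> X" using s(3) by blast+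
    then obtain t where t: "t \<in> G" "i < length t" "t ! i" unfolding X_def by blast
    obtain r where "(r, s) \<in> P" "(r, t) \<in> P"
      using G(1) s(1) t(1) unfolding forcing_filter_def by metis
    then obtain u v where "r = s @ u" "r = t @ v" unfolding P_def by blast
    then have "r ! i = s ! i" "r ! i = t ! i"
      using s(2) t(2) by (metis nth_append)+
    then show False using \<open>\<not> s ! i\<close> t by simp
  qed
  moreover have "|range E| \<le>o continuum" by (rule card_of_image)
  ultimately show ?thesis by blast
qed

lemma continuum_cardinal:
  assumes "|A| \<le>o continuum"
  obtains \<mu> :: "nat set rel" where "Card_order \<mu>" "|A| =o \<mu>"
proof -
  obtain B :: "nat set set" where "|A| =o |B|"
    using assms internalize_card_of_ordLeq[of A continuum] by auto
  then show thesis using that card_of_Card_order by blast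
qed

lemma m_sigma_n_linked_spec:
  "Card_order (m_sigma_n_linked n)" (is ?A)
  "\<exists>(P :: nat set rel) \<D>. forcing P \<and> sigma_n_linked n P \<and> |\<D>| =o m_sigma_n_linked n \<and>
     unmet_dense_sets P \<D>" (is ?B)
  "\<And>(\<nu> :: nat set rel) (P :: nat set rel) \<D>. Card_order \<nu> \<Longrightarrow> forcing P \<Longrightarrow> sigma_n_linked n P \<Longrightarrow>
     |\<D>| =o \<nu> \<Longrightarrow> unmet_dense_sets P \<D> \<Longrightarrow> m_sigma_n_linked n \<le>o \<nu>"
proof -
  let ?\<Phi> = "\<lambda>\<mu> :: nat set rel. \<exists>(P :: nat set rel) \<D>.
     forcing P \<and> sigma_n_linked n P \<and> |\<D>| =o \<mu> \<and> unmet_dense_sets P \<D>"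
  obtain P0 :: "bool list rel" and \<D>0 where 0: "forcing P0" "sigma_n_linked n P0"
    "unmet_dense_sets P0 \<D>0" "|\<D>0| \<le>o continuum" using Cohen_forcing[of n] by blast
  obtain P :: "nat set rel" and \<D> where P: "forcing P" "sigma_n_linked n P"
    "unmet_dense_sets P \<D>" "|\<D>| \<le>o |\<D>0|" using forcing_on_nat_sets[OF 0] by blast
  obtain \<mu> :: "nat set rel" where \<mu>: "Card_order \<mu>" "|\<D>| =o \<mu>"
    using continuum_cardinal[of \<D>] ordLeq_transitive[OF P(4) 0(4)] by blast
  have \<Phi>: "?\<Phi> \<mu>" using P \<mu> by blast
  note * = least_cardinal[of \<mu> ?\<Phi>, OF \<mu>(1) \<Phi>, folded m_sigma_n_linked_def]
  show ?A ?B using *(1,2) by blast+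
  show "\<And>(\<nu> :: nat set rel) (P :: nat set rel) \<D>. Card_order \<nu> \<Longrightarrow> forcing P \<Longrightarrow> sigma_n_linked n P \<Longrightarrow>
     |\<D>| =o \<nu> \<Longrightarrow> unmet_dense_sets P \<D> \<Longrightarrow> m_sigma_n_linked n \<le>o \<nu>"
    by (rule *(3)) blast+
qed

lemmas Card_order_m_sigma_n_linked = m_sigma_n_linked_spec(1)

theorem m_sigma_n_linked_attained:
  "\<exists>(P :: nat set rel) \<D>. forcing P \<and> sigma_n_linked n P \<and> |\<D>| =o m_sigma_n_linked n \<and>
     unmet_dense_sets P \<D>"
  by (rule m_sigma_n_linked_spec(2))

theorem m_sigma_n_linked_least:
  fixes P :: "'p rel"
  assumes "forcing P" "sigma_n_linked n P" "unmet_dense_sets P \<D>"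
  shows "m_sigma_n_linked n \<le>o |\<D>|"
proof (cases "|\<D>| \<le>o continuum")
  case True
  obtain P' :: "nat set rel" and \<D>' where P': "forcing P'" "sigma_n_linked n P'"
    "unmet_dense_sets P' \<D>'" "|\<D>'| \<le>o |\<D>|" using forcing_on_nat_sets[OF assms True] by blast
  obtain \<mu> :: "nat set rel" where \<mu>: "Card_order \<mu>" "|\<D>'| =o \<mu>"
    using continuum_cardinal[of \<D>'] ordLeq_transitive[OF P'(4) True] by blast
  have "m_sigma_n_linked n \<le>o \<mu>" using m_sigma_n_linked_spec(3)[OF \<mu>(1) P'(1,2) \<mu>(2) P'(3)] .
  also have "\<mu> =o |\<D>'|" using \<mu> ordIso_symmetric by blast
  finally show ?thesis using P'(4) ordLeq_transitive by blast
next
  case False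
  have "m_sigma_n_linked n =o |Field (m_sigma_n_linked n)|"
    using card_of_Field_ordIso[OF Card_order_m_sigma_n_linked] ordIso_symmetric by blast
  moreover have "|Field (m_sigma_n_linked n)| \<le>o continuum" by (rule card_of_mono1) simp
  moreover have "continuum \<le>o |\<D>|" using False ordLeq_total[OF card_of_Well_order card_of_Well_order] by blast
  ultimately show ?thesis using ordIso_ordLeq_trans ordLeq_transitive by blast
qed

end

theory Submission
  imports Defs
begin

text \<open>
  Suppose the neighbourhood filter of \<open>p\<close> is cofinally equivalent to \<open>\<kappa> \<times> D\<close>. The clopen sets
  \<open>star A\<close>, for \<open>A\<close> in the ultrafilter \<open>p\<close>, are cofinal among the neighbourhoods, and
  \<open>star A \<subseteq> star B\<close> means that \<open>A - B\<close> is finite (\<open>star_subset_iff\<close>). Write \<open>L \<alpha>\<close> for the set of those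
  \<open>A \<in> p\<close> for which \<open>star A\<close> lies below \<open>(\<alpha>, d)\<close> for some \<open>d\<close>. The sets \<open>L \<alpha>\<close> increase with \<open>\<alpha>\<close> and
  exhaust \<open>p\<close>. As at most \<open>\<kappa>\<close> many elements of \<open>D\<close> have a common bound, any at most \<open>\<kappa>\<close> many members
  of one \<open>L \<alpha>\<close> have a pseudo-intersection in \<open>p\<close>. As \<open>\<kappa>\<close> has no largest element, this fails for \<open>p\<close>
  itself: sets in \<open>p\<close> above the points \<open>(\<delta>, e)\<close>, with \<open>\<delta>\<close> running over \<open>\<kappa>\<close> and \<open>e\<close> fixed, have no
  pseudo-intersection in \<open>p\<close>.

  These two facts are in conflict. The first step
  (\<open>almost_disjoint_family_meeting_filter_sets\<close>) extracts from them an almost disjoint family \<open>C \<xi>\<close>, for \<open>\<xi> < \<kappa>\<close>, such that every set in \<open>p\<close> has an infinite intersection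
  with \<open>C \<xi>\<close> for all large \<open>\<xi>\<close>. The second step (\<open>colouring_avoiding_almost_disjoint_sets\<close>)
  produces generically a colouring of \<open>\<omega>\<close> with the \<open>n + 1\<close> colours \<open>0, \<dots>, n\<close> in which \<open>C \<xi>\<close> almost
  misses a colour \<open>z \<xi>\<close> chosen in advance. If each colour is chosen for cofinally many \<open>\<xi>\<close>, then
  every colour class is almost disjoint from cofinally many \<open>C \<xi>\<close>; but one of the colour classes
  belongs to the ultrafilter \<open>p\<close>.

  The hypothesis on \<open>\<kappa>\<close> enters through the second step. A condition is a colouring of an initial
  segment of \<open>\<omega>\<close> together with finitely many promises \<open>\<xi>\<close> not to use \<open>z \<xi>\<close> on \<open>C \<xi>\<close> from now on. Once
  the segment covers the overlaps of the promised sets, the condition forbids at most one colour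
  at each later point. So \<open>n\<close> conditions with the same colouring together leave one of the
  \<open>n + 1\<close> colours free everywhere (\<open>amalgamate_colourings\<close>), and as there are only countably many
  finite colourings, the forcing is \<open>\<sigma>\<close>-\<open>n\<close>-linked.
\<close>

section \<open>The forcing that colours \<open>\<omega>\<close>\<close>

text \<open>
  In a condition \<open>(s, F)\<close>, the stem \<open>s\<close> colours the points below \<open>length s\<close>, and \<open>F\<close> is the set of
  promises. Requiring the overlaps of the promised sets to lie below \<open>length s\<close> is what makes a
  condition forbid at most one colour at each uncoloured point.
\<close>

definition colouring_condition ::
    "'i set \<Rightarrow> ('i \<Rightarrow> nat set) \<Rightarrow> nat \<Rightarrow> nat list \<times> 'i set \<Rightarrow> bool" where
  "colouring_condition I C n p \<longleftrightarrow> set (fst p) \<subseteq> {..n} \<and> snd p \<subseteq> I \<and> finite (snd p) \<and>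
     (\<forall>\<xi>\<in>snd p. \<forall>\<eta>\<in>snd p. \<xi> \<noteq> \<eta> \<longrightarrow> C \<xi> \<inter> C \<eta> \<subseteq> {..<length (fst p)})"

definition colouring_extends ::
    "('i \<Rightarrow> nat set) \<Rightarrow> ('i \<Rightarrow> nat) \<Rightarrow> nat list \<times> 'i set \<Rightarrow> nat list \<times> 'i set \<Rightarrow> bool" where
  "colouring_extends C z q p \<longleftrightarrow> snd p \<subseteq> snd q \<and> length (fst p) \<le> length (fst q) \<and>
     take (length (fst p)) (fst q) = fst p \<and>
     (\<forall>m \<in> {length (fst p)..<length (fst q)}. \<forall>\<xi>\<in>snd p. m \<in> C \<xi> \<longrightarrow> fst q ! m \<noteq> z \<xi>)"

definition colouring_forcing ::
    "'i set \<Rightarrow> ('i \<Rightarrow> nat set) \<Rightarrow> ('i \<Rightarrow> nat) \<Rightarrow> nat \<Rightarrow> (nat list \<times> 'i set) rel" where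
  "colouring_forcing I C z n = {(q, p).
     colouring_condition I C n q \<and> colouring_condition I C n p \<and> colouring_extends C z q p}"

lemma colouring_extends_trans:
  assumes "colouring_extends C z r q" "colouring_extends C z q p"
  shows "colouring_extends C z r p"
proof -
  obtain u H t G s F where [simp]: "r = (u, H)" "q = (t, G)" "p = (s, F)"
    by (metis surj_pair)
  have a: "F \<subseteq> G" "G \<subseteq> H" "length s \<le> length t" "length t \<le> length u"
    "take (length t) u = t" "take (length s) t = s"
    "\<And>m \<xi>. m \<in> {length t..<length u} \<Longrightarrow> \<xi> \<in> G \<Longrightarrow> m \<in> C \<xi> \<Longrightarrow> u ! m \<noteq> z \<xi>"
    "\<And>m \<xi>. m \<in> {length s..<length t} \<Longrightarrow> \<xi> \<in> F \<Longrightarrow> m \<in> C \<xi> \<Longrightarrow> t ! m \<noteq> z \<xi>"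
    using assms by (auto simp: colouring_extends_def)
  have "take (length s) u = s" using a(3,5,6) by (metis min.absorb1 take_take)
  moreover have "u ! m \<noteq> z \<xi>" if "m \<in> {length s..<length u}" "\<xi> \<in> F" "m \<in> C \<xi>" for m \<xi>
  proof (cases "m < length t")
    case True
    then have "u ! m = t ! m" using a(5) by (metis nth_take)
    then show ?thesis using a(8) that True by auto
  qed (use a that in auto)
  ultimately show ?thesis using a by (auto simp: colouring_extends_def)
qed

lemma Field_colouring_forcing:
  "Field (colouring_forcing I C z n) = Collect (colouring_condition I C n)"
proof -
  have "colouring_extends C z p p" for p by (auto simp: colouring_extends_def)
  then show ?thesis by (auto simp: colouring_forcing_def Field_def)
qed

lemma forcing_colouring_forcing: "forcing (colouring_forcing I C z n)"
proof -
  have "colouring_extends C z p p" for p by (auto simp: colouring_extends_def)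
  moreover have "trans (colouring_forcing I C z n)"
    using colouring_extends_trans[of C z] by (auto simp: trans_def colouring_forcing_def)
  moreover have "colouring_condition I C n ([], {})" by (auto simp: colouring_condition_def)
  ultimately show ?thesis
    unfolding forcing_def preorder_on_def Field_colouring_forcing
    by (auto simp: refl_on_def) (auto simp: colouring_forcing_def)
qed

lemma finite_promises_bound:
  assumes I: "pairwise (\<lambda>\<xi> \<eta>. finite (C \<xi> \<inter> C \<eta> :: nat set)) I"
    and F: "finite F" "F \<subseteq> I"
  obtains k where "\<forall>\<xi>\<in>F. \<forall>\<eta>\<in>F. \<xi> \<noteq> \<eta> \<longrightarrow> C \<xi> \<inter> C \<eta> \<subseteq> {..<k}"
proof -
  have "finite (\<Union>\<xi>\<in>F. \<Union>\<eta>\<in>F-{\<xi>}. C \<xi> \<inter> C \<eta>)" using F pairwiseD[OF I] by (intro finite_UN_I) auto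
  from finite_nat_bounded[OF this]
  obtain k where "(\<Union>\<xi>\<in>F. \<Union>\<eta>\<in>F-{\<xi>}. C \<xi> \<inter> C \<eta>) \<subseteq> {..<k}" ..
  then have "\<forall>\<xi>\<in>F. \<forall>\<eta>\<in>F. \<xi> \<noteq> \<eta> \<longrightarrow> C \<xi> \<inter> C \<eta> \<subseteq> {..<k}" by blast
  then show thesis by (rule that)
qed

text \<open>
  Each of at most \<open>n\<close> conditions with the same stem forbids at most one colour at each new point,
  so one of the \<open>n + 1\<close> colours is always available and the stem can be prolonged as far as
  desired. Beyond the overlaps of a finite set \<open>H\<close> of indices, all of \<open>H\<close> can be promised. This
  gives \<open>n\<close>-linkedness and, with a single condition, the density arguments.
\<close>

lemma amalgamate_colourings:
  assumes I: "pairwise (\<lambda>\<xi> \<eta>. finite (C \<xi> \<inter> C \<eta>)) I"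
    and ps: "ps \<noteq> []" "length ps \<le> n" "\<And>p. p \<in> set ps \<Longrightarrow> colouring_condition I C n p"
      "\<And>p. p \<in> set ps \<Longrightarrow> fst p = s"
    and H: "finite H" "H \<subseteq> I" "\<And>p. p \<in> set ps \<Longrightarrow> snd p \<subseteq> H"
  obtains t where "k \<le> length t" "colouring_condition I C n (t, H)"
    "\<forall>p\<in>set ps. colouring_extends C z (t, H) p"
proof -
  obtain k' where k': "\<forall>\<xi>\<in>H. \<forall>\<eta>\<in>H. \<xi> \<noteq> \<eta> \<longrightarrow> C \<xi> \<inter> C \<eta> \<subseteq> {..<k'}"
    using finite_promises_bound[OF I H(1,2)] by blast
  define l where "l = max (length s) (max k k')"
  define bad where "bad m = (\<Union>p\<in>set ps. z ` {\<xi>\<in>snd p. m \<in> C \<xi>})" for m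
  \<comment> \<open>Beyond \<open>length s\<close> a single condition forbids at most one colour at each point, as there the
    sets it has made promises about are disjoint.\<close>
  have one: "card (z ` {\<xi>\<in>snd p. m \<in> C \<xi>}) \<le> 1" "finite (snd p)"
    if p: "p \<in> set ps" and m: "length s \<le> m" for p m
  proof -
    have c: "finite (snd p)"
      "\<And>\<xi> \<eta>. \<xi> \<in> snd p \<Longrightarrow> \<eta> \<in> snd p \<Longrightarrow> \<xi> \<noteq> \<eta> \<Longrightarrow> C \<xi> \<inter> C \<eta> \<subseteq> {..<length s}"
      using ps(3,4)[OF p] by (auto simp: colouring_condition_def)
    then show "finite (snd p)" by simp
    have eq: "\<xi> = \<eta>" if "\<xi> \<in> {\<xi>\<in>snd p. m \<in> C \<xi>}" "\<eta> \<in> {\<xi>\<in>snd p. m \<in> C \<xi>}" for \<xi> \<eta>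
      using c(2)[of \<xi> \<eta>] that m
      by (metis (no_types, lifting) IntI lessThan_iff mem_Collect_eq not_less subsetD)
    have "card {\<xi>\<in>snd p. m \<in> C \<xi>} \<le> 1"
      using eq c(1) by (subst One_nat_def, subst card_le_Suc0_iff_eq) auto
    then show "card (z ` {\<xi>\<in>snd p. m \<in> C \<xi>}) \<le> 1"
      using card_image_le[of "{\<xi>\<in>snd p. m \<in> C \<xi>}" z] c(1) by simp
  qed
  have ex: "\<exists>i\<le>n. i \<notin> bad m" if m: "length s \<le> m" for m
  proof -
    have "card (bad m) \<le> (\<Sum>p\<in>set ps. card (z ` {\<xi>\<in>snd p. m \<in> C \<xi>}))"
      unfolding bad_def by (rule card_UN_le) simp
    also have "\<dots> \<le> (\<Sum>p\<in>set ps. 1)" by (intro sum_mono one m)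
    also have "\<dots> \<le> n" using card_length[of ps] ps(2) by simp
    finally have "card (bad m) < card {..n}" by simp
    moreover have "finite (bad m)" using one(2) m by (auto simp: bad_def)
    ultimately have "\<not> {..n} \<subseteq> bad m" using card_mono[of "bad m" "{..n}"] by auto
    then show ?thesis by auto
  qed
  define c where "c m = (SOME i. i \<le> n \<and> i \<notin> bad m)" for m
  have c: "c m \<le> n" "c m \<notin> bad m" if "length s \<le> m" for m
    using someI_ex[OF ex[OF that]] unfolding c_def by blast+
  define t where "t = s @ map c [length s..<l]"
  have len: "length t = l" by (simp add: t_def l_def)
  have "set s \<subseteq> {..n}"
    using ps(3,4)[of "hd ps"] ps(1) by (simp add: colouring_condition_def)
  then have "set t \<subseteq> {..n}" using c(1) by (auto simp: t_def)
  moreover have "C \<xi> \<inter> C \<eta> \<subseteq> {..<length t}" if "\<xi> \<in> H" "\<eta> \<in> H" "\<xi> \<noteq> \<eta>" for \<xi> \<eta>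
  proof -
    have "C \<xi> \<inter> C \<eta> \<subseteq> {..<k'}" using k' that by blast
    also have "\<dots> \<subseteq> {..<length t}" by (auto simp: len l_def)
    finally show ?thesis .
  qed
  ultimately have cond: "colouring_condition I C n (t, H)"
    using H(1,2) by (simp add: colouring_condition_def)
  have nth: "t ! m = c m" if "m \<in> {length s..<length t}" for m
    using that by (auto simp: t_def nth_append)
  have ext: "\<forall>p\<in>set ps. colouring_extends C z (t, H) p"
  proof
    fix p assume p: "p \<in> set ps"
    have "c m \<noteq> z \<xi>" if "length s \<le> m" "\<xi> \<in> snd p" "m \<in> C \<xi>" for m \<xi>
      using c(2)[OF that(1)] that p by (auto simp: bad_def)
    then show "colouring_extends C z (t, H) p"
      using ps(4)[OF p] H(3)[OF p] nth by (auto simp: colouring_extends_def t_def)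
  qed
  have "k \<le> length t" by (simp add: len l_def)
  from that[OF this cond ext] show thesis .
qed

lemma sigma_n_linked_colouring_forcing:
  assumes n: "1 \<le> n"
    and I: "pairwise (\<lambda>\<xi> \<eta>. finite (C \<xi> \<inter> C \<eta>)) I"
  shows "sigma_n_linked n (colouring_forcing I C z n)"
  unfolding sigma_n_linked_def
proof (rule exI[of _ "\<lambda>i. {p. colouring_condition I C n p \<and> fst p = from_nat i}"], intro conjI allI)
  show "Field (colouring_forcing I C z n) =
      (\<Union>i. {p. colouring_condition I C n p \<and> fst p = from_nat i})"
  proof -
    have "\<exists>i. fst p = from_nat i" for p :: "nat list \<times> 'a set"
      by (rule exI[of _ "to_nat (fst p)"]) simp
    then show ?thesis unfolding Field_colouring_forcing by (intro equalityI subsetI) simp_all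
  qed
  fix i
  show "n_linked n (colouring_forcing I C z n) {p. colouring_condition I C n p \<and> fst p = from_nat i}"
    unfolding n_linked_def
  proof (intro allI impI)
    fix ps :: "(nat list \<times> 'a set) list"
    assume a: "length ps = n \<and> set ps \<subseteq> {p. colouring_condition I C n p \<and> fst p = from_nat i}"
    have snd: "finite (snd p)" "snd p \<subseteq> I" if "p \<in> set ps" for p
      using a that by (auto simp: colouring_condition_def)
    let ?H = "\<Union>p\<in>set ps. snd p"
    have ps: "ps \<noteq> []" "length ps \<le> n"
      "\<And>p. p \<in> set ps \<Longrightarrow> colouring_condition I C n p" "\<And>p. p \<in> set ps \<Longrightarrow> fst p = from_nat i"
      using a n by auto
    have H: "finite ?H" "?H \<subseteq> I" "\<And>p. p \<in> set ps \<Longrightarrow> snd p \<subseteq> ?H"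
      using snd by blast+
    obtain t where "colouring_condition I C n (t, ?H)"
      "\<forall>p\<in>set ps. colouring_extends C z (t, ?H) p"
      using amalgamate_colourings[OF I ps H, where k = 0 and z = z] by blast
    then show "\<exists>q\<in>Field (colouring_forcing I C z n).
        \<forall>p\<in>set ps. (q, p) \<in> colouring_forcing I C z n"
      using ps(3) unfolding Field_colouring_forcing
      by (intro bexI[of _ "(t, ?H)"]) (simp_all add: colouring_forcing_def)
  qed
qed

text \<open>
  The colouring is read off a filter meeting the \<open>\<kappa>\<close> many dense sets that make the stems long and
  that make the promise \<open>\<xi>\<close>. Once \<open>\<xi>\<close> has been promised by a condition with stem \<open>s\<close>, the colour
  \<open>z \<xi>\<close> can occur on \<open>C \<xi>\<close> only below \<open>length s\<close>.
\<close>

lemma colouring_avoiding_almost_disjoint_sets: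
  fixes \<kappa> :: "'k rel" and C :: "'i \<Rightarrow> nat set"
  assumes n: "1 \<le> n"
    and \<kappa>: "Card_order \<kappa>" "infinite (Field \<kappa>)" "\<kappa> <o m_sigma_n_linked n"
    and I: "|I| \<le>o \<kappa>" "pairwise (\<lambda>\<xi> \<eta>. finite (C \<xi> \<inter> C \<eta>)) I"
  shows "\<exists>c. (\<forall>m. c m \<le> n) \<and> (\<forall>\<xi>\<in>I. finite {m \<in> C \<xi>. c m = z \<xi>})"
proof -
  let ?P = "colouring_forcing I C z n"
  define long where "long k = {p. colouring_condition I C n p \<and> k < length (fst p)}" for k
  define promise where "promise \<xi> = {p. colouring_condition I C n p \<and> \<xi> \<in> snd p}" for \<xi>
  have ext: "\<exists>t. k \<le> length t \<and> colouring_condition I C n (t, F \<union> J) \<and>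
      colouring_extends C z (t, F \<union> J) (s, F)"
    if "colouring_condition I C n (s, F)" "finite J" "J \<subseteq> I" for s F J k
  proof -
    have "length [(s, F)] \<le> n" "\<And>p. p \<in> set [(s, F)] \<Longrightarrow> colouring_condition I C n p"
      "\<And>p. p \<in> set [(s, F)] \<Longrightarrow> fst p = s" "\<And>p. p \<in> set [(s, F)] \<Longrightarrow> snd p \<subseteq> F \<union> J"
      "finite (F \<union> J)" "F \<union> J \<subseteq> I"
      using that n by (auto simp: colouring_condition_def)
    note * = amalgamate_colourings[OF I(2) _ this(1-3,5,6,4), where k = k and z = z]
    show ?thesis by (rule *) auto
  qed
  have dense: "dense_subset ?P (long k)" for k
    unfolding dense_subset_def Field_colouring_forcing
  proof (intro conjI ballI)
    fix p assume "p \<in> Collect (colouring_condition I C n)"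
    then have p: "colouring_condition I C n (fst p, snd p)" by simp
    show "\<exists>d\<in>long k. (d, p) \<in> ?P"
      using ext[OF p, of "{}" "Suc k"] p unfolding long_def colouring_forcing_def
      by (fastforce simp: Suc_le_eq)
  qed (auto simp: long_def)
  have dense': "dense_subset ?P (promise \<xi>)" if \<xi>: "\<xi> \<in> I" for \<xi>
    unfolding dense_subset_def Field_colouring_forcing
  proof (intro conjI ballI)
    fix p assume "p \<in> Collect (colouring_condition I C n)"
    then have p: "colouring_condition I C n (fst p, snd p)" by simp
    show "\<exists>d\<in>promise \<xi>. (d, p) \<in> ?P"
      using ext[OF p, of "{\<xi>}" 0] p \<xi> unfolding promise_def colouring_forcing_def
      by fastforce
  qed (auto simp: promise_def)
  let ?\<D> = "range long \<union> promise ` I"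
  have "|range long| \<le>o \<kappa>"
    using card_of_image[of long UNIV] infinite_iff_card_of_nat[of "Field \<kappa>"] \<kappa>(2)
      card_of_Field_ordIso[OF \<kappa>(1)] ordLeq_transitive ordLeq_ordIso_trans by blast
  moreover have "|promise ` I| \<le>o \<kappa>" using card_of_image[of promise I] I(1) ordLeq_transitive by blast
  ultimately have "|?\<D>| \<le>o \<kappa>" using card_of_Un_ordLeq_infinite_Field \<kappa>(1,2) by blast
  then have "|?\<D>| <o m_sigma_n_linked n" using \<kappa>(3) ordLeq_ordLess_trans by blast
  then have "\<not> unmet_dense_sets ?P ?\<D>"
    using m_sigma_n_linked_least[OF forcing_colouring_forcing
        sigma_n_linked_colouring_forcing[OF n I(2)]] not_ordLess_ordLeq by blast
  moreover have "\<forall>D\<in>?\<D>. dense_subset ?P D" using dense dense' by auto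
  ultimately have "\<exists>G. forcing_filter ?P G \<and> (\<forall>D\<in>?\<D>. G \<inter> D \<noteq> {})"
    unfolding unmet_dense_sets_def by argo
  then obtain G where G: "forcing_filter ?P G" "\<forall>D\<in>?\<D>. G \<inter> D \<noteq> {}" by (elim exE conjE)
  have G_long: "\<exists>p\<in>G. m < length (fst p)" for m
  proof -
    have "G \<inter> long m \<noteq> {}" by (rule bspec[OF G(2)]) simp
    then show ?thesis by (auto simp: long_def)
  qed
  have cond: "colouring_condition I C n p" if "p \<in> G" for p
    using that G(1) Field_colouring_forcing[of I C z n] unfolding forcing_filter_def by blast
  have common: "\<exists>r\<in>G. colouring_extends C z r p \<and> colouring_extends C z r q"
    if "p \<in> G" "q \<in> G" for p q
  proof -
    have "\<exists>r\<in>G. (r, p) \<in> ?P \<and> (r, q) \<in> ?P" using G(1) that unfolding forcing_filter_def by blast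
    then show ?thesis unfolding colouring_forcing_def by blast
  qed
  have ext_nth: "fst r ! m = fst p ! m" "length (fst p) \<le> length (fst r)"
    if "colouring_extends C z r p" "m < length (fst p)" for r p m
    using that by (auto simp: colouring_extends_def) (metis nth_take)
  define c where "c m = fst (SOME p. p \<in> G \<and> m < length (fst p)) ! m" for m
  \<comment> \<open>The choice is immaterial, since any two stems in the filter agree where both are defined.\<close>
  have c: "c m = fst p ! m" if p: "p \<in> G" "m < length (fst p)" for p m
  proof -
    let ?q = "SOME p. p \<in> G \<and> m < length (fst p)"
    have q: "?q \<in> G" "m < length (fst ?q)"
      using someI_ex[of "\<lambda>p. p \<in> G \<and> m < length (fst p)"] G_long by blast+
    obtain r where r: "colouring_extends C z r p" "colouring_extends C z r ?q"
      using common[OF p(1) q(1)] by blast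
    have "c m = fst ?q ! m" by (simp only: c_def)
    also have "\<dots> = fst p ! m" using ext_nth(1)[OF r(1) p(2)] ext_nth(1)[OF r(2) q(2)] by simp
    finally show ?thesis .
  qed
  have "c m \<le> n" for m
  proof -
    obtain p where p: "p \<in> G" "m < length (fst p)" using G_long by blast
    have "set (fst p) \<subseteq> {..n}" using cond[OF p(1)] by (auto simp: colouring_condition_def)
    then show ?thesis using c[OF p] nth_mem[OF p(2)] by auto
  qed
  moreover have "finite {m \<in> C \<xi>. c m = z \<xi>}" if "\<xi> \<in> I" for \<xi>
  proof -
    have "G \<inter> promise \<xi> \<noteq> {}" by (rule bspec[OF G(2)]) (use that in simp)
    then obtain p where p: "p \<in> G" "\<xi> \<in> snd p" by (auto simp: promise_def)
    have "m < length (fst p)" if m: "m \<in> C \<xi>" "c m = z \<xi>" for m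
    proof (rule ccontr)
      assume nl: "\<not> m < length (fst p)"
      obtain q where q: "q \<in> G" "m < length (fst q)" using G_long by blast
      obtain r where r: "r \<in> G" "colouring_extends C z r p" "colouring_extends C z r q"
        using common[OF p(1) q(1)] by blast
      have m_r: "m < length (fst r)" using ext_nth(2)[OF r(3) q(2)] q(2) by simp
      then have "fst r ! m \<noteq> z \<xi>"
        using r(2) nl p(2) m(1) by (auto simp: colouring_extends_def)
      then show False using c[OF r(1) m_r] m(2) by simp
    qed
    then have "{m \<in> C \<xi>. c m = z \<xi>} \<subseteq> {..<length (fst p)}" by auto
    then show ?thesis using finite_subset by blast
  qed
  ultimately show ?thesis by blast
qed

section \<open>An almost disjoint family that every set in the ultrafilter meets\<close>

text \<open>
  By recursion on \<open>\<xi>\<close>, choose \<open>U, V \<in> p\<close> so that \<open>U\<close> is almost contained in all earlier \<open>V\<close> and no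
  \<open>X \<in> L \<xi>\<close> satisfies \<open>X \<inter> U \<subseteq>\<^sup>* V\<close> (inclusion up to finitely many points); then put
  \<open>C \<xi> = U - V\<close>. The first requirement makes these sets almost disjoint. It can be met because, by
  regularity, fewer than \<open>\<kappa>\<close> many members of \<open>p\<close> lie in a single \<open>L i\<close> and therefore have a
  pseudo-intersection. The second requirement makes every \<open>X \<in> L \<beta>\<close> meet \<open>C \<xi>\<close> infinitely often
  for \<open>\<xi> \<ge> \<beta>\<close>, since \<open>L \<beta> \<subseteq> L \<xi>\<close>. It can be met by some \<open>V\<close> from the unbounded family \<open>\<V>\<close>: otherwise
  each \<open>V \<in> \<V>\<close> has a witness \<open>X \<in> L \<xi>\<close> with \<open>X \<inter> U \<subseteq>\<^sup>* V\<close>, and a pseudo-intersection of the at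
  most \<open>\<kappa>\<close> many witnesses, cut down to \<open>U\<close>, is a pseudo-intersection of \<open>\<V>\<close>.
\<close>

lemma almost_disjoint_family_meeting_filter_sets:
  fixes \<kappa> :: "'k rel" and p :: "nat filter" and L :: "'k \<Rightarrow> nat set set"
  assumes \<kappa>: "Card_order \<kappa>" "regularCard \<kappa>"
    and mono: "relChain \<kappa> L"
    and cover: "(\<Union>\<xi>\<in>Field \<kappa>. L \<xi>) = {A. eventually (\<lambda>m. m \<in> A) p}"
    and bounded: "\<And>\<alpha> \<X>. \<alpha> \<in> Field \<kappa> \<Longrightarrow> \<X> \<subseteq> L \<alpha> \<Longrightarrow> |\<X>| \<le>o \<kappa> \<Longrightarrow>
      \<exists>Y. eventually (\<lambda>m. m \<in> Y) p \<and> (\<forall>X\<in>\<X>. finite (Y - X))"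
    and unbounded: "|\<V>| \<le>o \<kappa>" "\<forall>V\<in>\<V>. eventually (\<lambda>m. m \<in> V) p"
      "\<not> (\<exists>Y. eventually (\<lambda>m. m \<in> Y) p \<and> (\<forall>V\<in>\<V>. finite (Y - V)))"
  obtains C :: "'k \<Rightarrow> nat set" where
    "pairwise (\<lambda>\<xi> \<eta>. finite (C \<xi> \<inter> C \<eta>)) (Field \<kappa>)"
    "\<forall>X. eventually (\<lambda>m. m \<in> X) p \<longrightarrow>
      (\<exists>\<beta>\<in>Field \<kappa>. \<forall>\<xi>. (\<beta>, \<xi>) \<in> \<kappa> \<longrightarrow> infinite (X \<inter> C \<xi>))"
proof -
  let ?\<U> = "{A. eventually (\<lambda>m. m \<in> A) p}"
  have wo: "Well_order \<kappa>" using \<kappa>(1) by (rule card_order_on_well_order_on)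
  have narrow: "\<exists>V\<in>?\<U>. \<forall>X\<in>L \<xi>. infinite (X \<inter> U - V)" if U: "U \<in> ?\<U>" and \<xi>: "\<xi> \<in> Field \<kappa>" for U \<xi>
  proof (rule ccontr)
    assume "\<not> ?thesis"
    then have "\<forall>V\<in>\<V>. \<exists>X\<in>L \<xi>. finite (X \<inter> U - V)" using unbounded(2) by blast
    then obtain x where x: "\<And>V. V \<in> \<V> \<Longrightarrow> x V \<in> L \<xi>" "\<And>V. V \<in> \<V> \<Longrightarrow> finite (x V \<inter> U - V)"
      by metis
    have "|x ` \<V>| \<le>o \<kappa>" using card_of_image unbounded(1) by (rule ordLeq_transitive)
    then obtain Y where Y: "eventually (\<lambda>m. m \<in> Y) p" "\<forall>X\<in>x ` \<V>. finite (Y - X)"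
      using bounded[OF \<xi>, of "x ` \<V>"] x(1) by blast
    have "eventually (\<lambda>m. m \<in> Y \<inter> U) p" using Y(1) U by (simp add: eventually_conj_iff)
    moreover have "finite (Y \<inter> U - V)" if V: "V \<in> \<V>" for V
    proof (rule finite_subset)
      show "Y \<inter> U - V \<subseteq> (x V \<inter> U - V) \<union> (Y - x V)" by blast
      show "finite ((x V \<inter> U - V) \<union> (Y - x V))" using x(2)[OF V] Y(2) V by simp
    qed
    ultimately show False using unbounded(3) by blast
  qed
  define good where "good f \<xi> r \<longleftrightarrow> (\<xi> \<in> Field \<kappa> \<longrightarrow> fst r \<in> ?\<U> \<and> snd r \<in> ?\<U> \<and>
      (\<forall>\<eta>. (\<eta>, \<xi>) \<in> \<kappa> - Id \<longrightarrow> finite (fst r - snd (f \<eta>))) \<and> (\<forall>X\<in>L \<xi>. infinite (X \<inter> fst r - snd r)))"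
    for f :: "'k \<Rightarrow> nat set \<times> nat set" and \<xi> r
  have "\<exists>f. \<forall>\<xi>. good f \<xi> (f \<xi>)"
  proof (rule dependent_wf_choice)
    show "wf (\<kappa> - Id)" using wo by (simp add: well_order_on_def)
    show "good f \<xi> r = good g \<xi> r" if "\<And>\<eta>. (\<eta>, \<xi>) \<in> \<kappa> - Id \<Longrightarrow> f \<eta> = g \<eta>" for f g \<xi> r
    proof -
      have "(\<forall>\<eta>. (\<eta>, \<xi>) \<in> \<kappa> - Id \<longrightarrow> finite (fst r - snd (f \<eta>))) \<longleftrightarrow>
        (\<forall>\<eta>. (\<eta>, \<xi>) \<in> \<kappa> - Id \<longrightarrow> finite (fst r - snd (g \<eta>)))" using that by simp
      then show ?thesis unfolding good_def by simp
    qed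
    fix \<xi> f assume IH: "\<And>\<eta>. (\<eta>, \<xi>) \<in> \<kappa> - Id \<Longrightarrow> good f \<eta> (f \<eta>)"
    show "\<exists>r. good f \<xi> r"
    proof (cases "\<xi> \<in> Field \<kappa>")
      case True
      let ?\<A> = "(\<lambda>\<eta>. snd (f \<eta>)) ` underS \<kappa> \<xi>"
      have "snd (f \<eta>) \<in> ?\<U>" if "\<eta> \<in> underS \<kappa> \<xi>" for \<eta>
        using IH[of \<eta>] that unfolding good_def underS_def by (auto simp: FieldI1)
      then have "?\<A> \<subseteq> (\<Union>\<xi>\<in>Field \<kappa>. L \<xi>)" unfolding cover by blast
      moreover have small: "|?\<A>| <o \<kappa>"
        using card_of_image card_of_underS[OF \<kappa>(1) True] by (rule ordLeq_ordLess_trans)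
      ultimately obtain i where i: "i \<in> Field \<kappa>" "?\<A> \<subseteq> L i"
        using regularCard_UNION[OF \<kappa> mono] by blast
      obtain U where U: "U \<in> ?\<U>" "\<forall>X\<in>?\<A>. finite (U - X)"
        using bounded[OF i] ordLess_imp_ordLeq[OF small] by auto
      obtain V where V: "V \<in> ?\<U>" "\<forall>X\<in>L \<xi>. infinite (X \<inter> U - V)"
        using narrow[OF U(1) True] by blast
      have "good f \<xi> (U, V)" using U V by (simp add: good_def underS_def)
      then show ?thesis by blast
    qed (simp add: good_def)
  qed
  then obtain f where f: "\<And>\<xi>. good f \<xi> (f \<xi>)" by blast
  define C where "C \<xi> = fst (f \<xi>) - snd (f \<xi>)" for \<xi>
  have fin: "finite (C \<xi> \<inter> C \<eta>)" if "(\<eta>, \<xi>) \<in> \<kappa>" "\<eta> \<noteq> \<xi>" for \<xi> \<eta>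
  proof (rule finite_subset)
    show "C \<xi> \<inter> C \<eta> \<subseteq> fst (f \<xi>) - snd (f \<eta>)" by (auto simp: C_def)
    show "finite (fst (f \<xi>) - snd (f \<eta>))"
      using f[of \<xi>] that FieldI2[OF that(1)] by (simp add: good_def)
  qed
  have "pairwise (\<lambda>\<xi> \<eta>. finite (C \<xi> \<inter> C \<eta>)) (Field \<kappa>)"
  proof (rule pairwiseI)
    fix \<xi> \<eta> assume "\<xi> \<in> Field \<kappa>" "\<eta> \<in> Field \<kappa>" "\<xi> \<noteq> \<eta>"
    then have "(\<eta>, \<xi>) \<in> \<kappa> \<or> (\<xi>, \<eta>) \<in> \<kappa>"
      using wo unfolding well_order_on_def linear_order_on_def total_on_def by blast
    then show "finite (C \<xi> \<inter> C \<eta>)" using fin[of \<eta> \<xi>] fin[of \<xi> \<eta>] \<open>\<xi> \<noteq> \<eta>\<close> by (auto simp: Int_commute)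
  qed
  moreover have "\<forall>X. eventually (\<lambda>m. m \<in> X) p \<longrightarrow>
      (\<exists>\<beta>\<in>Field \<kappa>. \<forall>\<xi>. (\<beta>, \<xi>) \<in> \<kappa> \<longrightarrow> infinite (X \<inter> C \<xi>))"
  proof (intro allI impI)
    fix X assume X: "eventually (\<lambda>m. m \<in> X) p"
    have "X \<in> (\<Union>\<xi>\<in>Field \<kappa>. L \<xi>)" unfolding cover using X by simp
    then obtain \<beta> where \<beta>: "\<beta> \<in> Field \<kappa>" "X \<in> L \<beta>" by blast
    have "infinite (X \<inter> C \<xi>)" if "(\<beta>, \<xi>) \<in> \<kappa>" for \<xi>
    proof -
      have "X \<in> L \<xi>" using mono \<beta>(2) that unfolding relChain_def by blast
      then have "infinite (X \<inter> fst (f \<xi>) - snd (f \<xi>))"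
        using f[of \<xi>] FieldI2[OF that] unfolding good_def by blast
      then show ?thesis by (simp add: C_def Int_Diff)
    qed
    then show "\<exists>\<beta>\<in>Field \<kappa>. \<forall>\<xi>. (\<beta>, \<xi>) \<in> \<kappa> \<longrightarrow> infinite (X \<inter> C \<xi>)" using \<beta>(1) by blast
  qed
  ultimately show thesis by (rule that)
qed

lemma ultrafilter_contains_colour_class:
  assumes p: "ultrafilter p" and c: "\<forall>m. c m \<le> (n :: nat)"
  shows "\<exists>i. i \<le> n \<and> eventually (\<lambda>m. c m = i) p"
proof (rule ccontr)
  assume "\<not> ?thesis"
  then have "\<forall>i\<in>{..n}. eventually (\<lambda>m. c m \<noteq> i) p"
    using p unfolding ultrafilter_def by auto
  then have "eventually (\<lambda>m. \<forall>i\<in>{..n}. c m \<noteq> i) p" by (intro eventually_ball_finite) auto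
  then have "eventually (\<lambda>m. False) p" by (rule eventually_mono) (use c in auto)
  then show False using p by (simp add: ultrafilter_def trivial_limit_def)
qed

text \<open>
  A bijection \<open>h\<close> from \<open>\<kappa> \<times> {0, \<dots>, n}\<close> to \<open>\<kappa>\<close> splits \<open>\<kappa>\<close> into \<open>n + 1\<close> pieces of size \<open>\<kappa>\<close>, one for
  each colour. A set of size \<open>\<kappa>\<close> is cofinal in \<open>\<kappa>\<close>, because proper initial segments are smaller.
\<close>

lemma ultrafilter_set_almost_missing_cofinally_many:
  fixes \<kappa> :: "'k rel" and C :: "'k \<Rightarrow> nat set"
  assumes n: "1 \<le> n"
    and \<kappa>: "Card_order \<kappa>" "infinite (Field \<kappa>)" "\<kappa> <o m_sigma_n_linked n"
    and p: "ultrafilter p"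
    and C: "pairwise (\<lambda>\<xi> \<eta>. finite (C \<xi> \<inter> C \<eta>)) (Field \<kappa>)"
  shows "\<exists>X. eventually (\<lambda>m. m \<in> X) p \<and> (\<forall>\<beta>\<in>Field \<kappa>. \<exists>\<xi>. (\<beta>, \<xi>) \<in> \<kappa> \<and> finite (X \<inter> C \<xi>))"
proof -
  have wo: "Well_order \<kappa>" using \<kappa>(1) by (rule card_order_on_well_order_on)
  have "|{..n}| \<le>o |Field \<kappa>|"
    using card_of_ordLeq_infinite \<kappa>(2) by (meson card_of_Well_order finite_atMost ordLeq_total)
  then have "|Field \<kappa> \<times> {..n}| =o |Field \<kappa>|"
    using card_of_Times_infinite[OF \<kappa>(2), of "{..n}"] by auto
  then obtain h where h: "bij_betw h (Field \<kappa> \<times> {..n}) (Field \<kappa>)"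
    using card_of_ordIso by blast
  have hF: "h (\<xi>, i) \<in> Field \<kappa>" if "\<xi> \<in> Field \<kappa>" "i \<le> n" for \<xi> i
    using h that by (auto simp: bij_betw_def)
  have "|Field \<kappa> \<times> {..n}| \<le>o \<kappa>"
    using \<open>|Field \<kappa> \<times> {..n}| =o |Field \<kappa>|\<close> card_of_Field_ordIso[OF \<kappa>(1)]
      ordIso_transitive ordIso_imp_ordLeq by blast
  moreover have "pairwise (\<lambda>x y. finite (C (h x) \<inter> C (h y))) (Field \<kappa> \<times> {..n})"
  proof (rule pairwiseI)
    fix x y assume xy: "x \<in> Field \<kappa> \<times> {..n}" "y \<in> Field \<kappa> \<times> {..n}" "x \<noteq> y"
    then have "h x \<noteq> h y" "h x \<in> Field \<kappa>" "h y \<in> Field \<kappa>"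
      using h by (auto simp: bij_betw_def dest: inj_onD)
    then show "finite (C (h x) \<inter> C (h y))" using pairwiseD[OF C] by blast
  qed
  ultimately have "\<exists>c. (\<forall>m. c m \<le> n) \<and>
      (\<forall>x\<in>Field \<kappa> \<times> {..n}. finite {m \<in> C (h x). c m = snd x})"
    by (rule colouring_avoiding_almost_disjoint_sets[OF n \<kappa>])
  then obtain c where c: "\<forall>m. c m \<le> n"
    "\<forall>x\<in>Field \<kappa> \<times> {..n}. finite {m \<in> C (h x). c m = snd x}" by (elim exE conjE)
  obtain i where i: "i \<le> n" "eventually (\<lambda>m. c m = i) p"
    using ultrafilter_contains_colour_class[OF p c(1)] by (elim exE conjE)
  have "\<exists>\<xi>. (\<beta>, \<xi>) \<in> \<kappa> \<and> finite ({m. c m = i} \<inter> C \<xi>)" if \<beta>: "\<beta> \<in> Field \<kappa>" for \<beta>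
  proof (rule ccontr)
    assume no: "\<not> ?thesis"
    have "h (\<xi>, i) \<in> underS \<kappa> \<beta>" if \<xi>: "\<xi> \<in> Field \<kappa>" for \<xi>
    proof -
      have "finite ({m. c m = i} \<inter> C (h (\<xi>, i)))"
        using bspec[OF c(2), of "(\<xi>, i)"] \<xi> i(1) by (simp add: Collect_conj_eq Int_commute)
      then have nb: "(\<beta>, h (\<xi>, i)) \<notin> \<kappa>" using no by blast
      moreover have "(\<beta>, \<beta>) \<in> \<kappa>"
        using wo \<beta> by (simp add: order_on_defs refl_on_def)
      ultimately have "h (\<xi>, i) \<noteq> \<beta>" by metis
      moreover from this have "(h (\<xi>, i), \<beta>) \<in> \<kappa>"
        using wo nb \<beta> hF[OF \<xi> i(1)] unfolding well_order_on_def linear_order_on_def total_on_def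
        by blast
      ultimately show ?thesis by (simp add: underS_def)
    qed
    moreover have "inj_on (\<lambda>\<xi>. h (\<xi>, i)) (Field \<kappa>)"
      using h i(1) by (auto simp: bij_betw_def inj_on_def)
    ultimately have "|Field \<kappa>| \<le>o |underS \<kappa> \<beta>|" using card_of_ordLeq by blast
    then have "|Field \<kappa>| <o \<kappa>" using card_of_underS[OF \<kappa>(1) \<beta>] by (rule ordLeq_ordLess_trans)
    then show False using card_of_Field_ordIso[OF \<kappa>(1)] not_ordLess_ordIso by blast
  qed
  then show ?thesis using i(2) by (intro exI[of _ "{m. c m = i}"]) simp
qed

section \<open>Neighbourhoods in \<open>\<beta>\<omega> - \<omega>\<close>\<close>

text \<open>
  In the order of filters, finer filters are smaller, so Zorn's lemma is applied to \<open>\<ge>\<close>. A chain of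
  proper filters is bounded by its infimum, which is proper because chains are directed.
\<close>

lemma exists_finer_ultrafilter:
  assumes "F \<noteq> (bot :: 'a filter)"
  obtains G where "ultrafilter G" "G \<le> F"
proof -
  let ?A = "{G. G \<noteq> bot \<and> G \<le> F}"
  have "\<exists>m\<in>?A. \<forall>a\<in>?A. m \<ge> a \<longrightarrow> a = m"
  proof (rule predicate_Zorn)
    show "partial_order_on ?A (relation_of (\<ge>) ?A)" by (rule partial_order_on_relation_ofI) auto
    fix Ch assume Ch: "Ch \<in> Chains (relation_of (\<ge>) ?A)"
    then have sub: "Ch \<subseteq> ?A" and lin: "\<And>G H. G \<in> Ch \<Longrightarrow> H \<in> Ch \<Longrightarrow> G \<le> H \<or> H \<le> G"
      by (auto simp: Chains_def relation_of_def)
    show "\<exists>u\<in>?A. \<forall>a\<in>Ch. a \<ge> u"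
    proof (cases "Ch = {}")
      case False
      have "eventually P (Inf Ch) \<longleftrightarrow> (\<exists>b\<in>Ch. eventually P b)" for P
      proof (rule eventually_Inf_base[OF False])
        show "\<exists>x\<in>Ch. x \<le> inf G H" if "G \<in> Ch" "H \<in> Ch" for G H
          using lin[OF that] that by (auto intro: bexI[of _ G] bexI[of _ H])
      qed
      then have "Inf Ch \<noteq> bot" using sub unfolding trivial_limit_def by blast
      moreover have "Inf Ch \<le> F" using False sub by (auto intro: Inf_lower2)
      ultimately show ?thesis by (auto intro: Inf_lower)
    qed (use assms in auto)
  qed
  then obtain G where G: "G \<noteq> bot" "G \<le> F" "\<And>H. H \<noteq> bot \<Longrightarrow> H \<le> F \<Longrightarrow> H \<le> G \<Longrightarrow> H = G" by auto
  have "eventually S G \<or> eventually (\<lambda>x. \<not> S x) G" for S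
  proof (rule disjCI)
    assume "\<not> eventually (\<lambda>x. \<not> S x) G"
    then have "inf G (principal (Collect S)) \<noteq> bot"
      by (simp add: trivial_limit_def eventually_inf_principal)
    then have "inf G (principal (Collect S)) = G" using G(2) by (intro G(3)) (auto intro: le_infI1)
    then have "G \<le> principal (Collect S)" by (simp add: inf.absorb_iff1)
    then show "eventually S G" by (simp add: le_principal)
  qed
  then have "ultrafilter G" using G(1) by (simp add: ultrafilter_def)
  then show thesis using G(2) that by blast
qed

lemma in_topspace_omega_star_iff:
  "F \<in> topspace omega_star \<longleftrightarrow> ultrafilter F \<and> F \<le> cofinite"
proof -
  have "F \<in> range (\<lambda>n. principal {n}) \<longleftrightarrow> \<not> F \<le> cofinite" if F: "ultrafilter F"
  proof
    assume "\<not> F \<le> cofinite"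
    then obtain S where S: "finite {x. \<not> S x}" "\<not> eventually S F"
      by (auto simp: le_filter_def eventually_cofinite)
    have "\<exists>n. \<not> eventually (\<lambda>x. x \<noteq> n) F"
    proof (rule ccontr)
      assume "\<not> ?thesis"
      then have "eventually (\<lambda>x. \<forall>n\<in>{x. \<not> S x}. x \<noteq> n) F"
        using S(1) by (intro eventually_ball_finite) auto
      then have "eventually S F" by (rule eventually_mono) blast
      then show False using S(2) by contradiction
    qed
    then obtain n where n: "eventually (\<lambda>x. x = n) F" using F unfolding ultrafilter_def by metis
    have "eventually P F \<longleftrightarrow> P n" for P
    proof
      show "P n" if "eventually P F"
      proof (rule ccontr)
        assume "\<not> P n"
        have "eventually (\<lambda>x. False) F"
          using eventually_conj[OF n that] by (rule eventually_mono) (use \<open>\<not> P n\<close> in auto)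
        then show False using F by (simp add: ultrafilter_def trivial_limit_def)
      qed
      show "eventually P F" if "P n" using n by (rule eventually_mono) (use that in auto)
    qed
    then have "F = principal {n}" by (simp add: filter_eq_iff eventually_principal)
    then show "F \<in> range (\<lambda>n. principal {n})" by blast
  next
    assume "F \<in> range (\<lambda>n. principal {n})"
    then show "\<not> F \<le> cofinite"
      by (auto simp: le_filter_def eventually_cofinite eventually_principal intro: exI[of _ "\<lambda>x. x \<noteq> _"])
  qed
  then show ?thesis unfolding omega_star_def topspace_subtopology topspace_beta_omega by blast
qed

definition star :: "nat set \<Rightarrow> nat filter set" where
  "star A = {F \<in> topspace omega_star. eventually (\<lambda>n. n \<in> A) F}"

text \<open>
  The forward direction needs enough points in the remainder: an infinite difference \<open>A - B\<close>
  belongs to a free ultrafilter, which lies in \<open>star A\<close> but not in \<open>star B\<close>.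
\<close>

lemma star_subset_iff: "star A \<subseteq> star B \<longleftrightarrow> finite (A - B)"
proof
  assume fin: "finite (A - B)"
  show "star A \<subseteq> star B"
  proof
    fix F assume "F \<in> star A"
    then have F: "F \<in> topspace omega_star" "eventually (\<lambda>n. n \<in> A) F" by (auto simp: star_def)
    have "eventually (\<lambda>n. n \<notin> A - B) cofinite"
      using fin by (simp add: eventually_cofinite set_diff_eq)
    then have "eventually (\<lambda>n. n \<notin> A - B) F"
      using F(1) unfolding in_topspace_omega_star_iff le_filter_def by blast
    with F(2) have "eventually (\<lambda>n. n \<in> B) F" by eventually_elim simp
    then show "F \<in> star B" using F(1) by (simp add: star_def)
  qed
next
  assume sub: "star A \<subseteq> star B"
  show "finite (A - B)"
  proof (rule ccontr)
    assume "infinite (A - B)"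
    then have "inf cofinite (principal (A - B)) \<noteq> bot"
      by (simp add: trivial_limit_def eventually_inf_principal eventually_cofinite set_diff_eq)
    then obtain F where F: "ultrafilter F" "F \<le> cofinite" "F \<le> principal (A - B)"
      using exists_finer_ultrafilter by (metis le_inf_iff)
    then have ev: "eventually (\<lambda>n. n \<in> A - B) F" by (simp add: le_principal)
    have "F \<in> star A" using F ev by (auto simp: star_def in_topspace_omega_star_iff elim: eventually_mono)
    then have "eventually (\<lambda>n. n \<in> B) F" using sub by (auto simp: star_def)
    with ev have "eventually (\<lambda>n. False) F" by eventually_elim simp
    then show False using F(1) by (simp add: ultrafilter_def trivial_limit_def)
  qed
qed

lemma openin_omega_star_star: "openin omega_star (star A)"
proof -
  have "openin beta_omega {F. ultrafilter F \<and> eventually (\<lambda>n. n \<in> A) F}"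
    unfolding beta_omega_def by (rule topology_generated_by_Basis) simp
  moreover have "star A = {F. ultrafilter F \<and> eventually (\<lambda>n. n \<in> A) F} \<inter> - range (\<lambda>n. principal {n})"
    unfolding star_def omega_star_def topspace_subtopology topspace_beta_omega by blast
  ultimately show ?thesis unfolding omega_star_def openin_subtopology by blast
qed

lemma openin_beta_omega_contains_basic:
  assumes "openin beta_omega T" "F \<in> T"
  shows "\<exists>A. eventually (\<lambda>n. n \<in> A) F \<and> {G. ultrafilter G \<and> eventually (\<lambda>n. n \<in> A) G} \<subseteq> T"
proof -
  have "generate_topology_on (range (\<lambda>A. {F. ultrafilter F \<and> eventually (\<lambda>n. n \<in> A) F})) T"
    using assms(1) unfolding beta_omega_def openin_topology_generated_by_iff .
  then show ?thesis using assms(2)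
  proof induction
    case (Int S T)
    then obtain A B where AB: "eventually (\<lambda>n. n \<in> A) F" "eventually (\<lambda>n. n \<in> B) F"
      "{G. ultrafilter G \<and> eventually (\<lambda>n. n \<in> A) G} \<subseteq> S"
      "{G. ultrafilter G \<and> eventually (\<lambda>n. n \<in> B) G} \<subseteq> T" by blast
    then show ?case by (intro exI[of _ "A \<inter> B"]) (auto simp: eventually_conj_iff)
  next
    case (UN K)
    then obtain k where "k \<in> K" "F \<in> k" by blast
    then show ?case using UN.IH by blast
  qed auto
qed

lemma star_in_nbhds_of:
  assumes "p \<in> topspace omega_star" "eventually (\<lambda>n. n \<in> A) p"
  shows "star A \<in> nbhds_of p omega_star"
  using assms openin_omega_star_star[of A]
  by (auto simp: nbhds_of_def interior_of_openin star_def)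

lemma nbhds_of_contains_star:
  assumes "U \<in> nbhds_of p omega_star"
  obtains A where "eventually (\<lambda>n. n \<in> A) p" "star A \<subseteq> U"
proof -
  obtain T where T: "openin omega_star T" "p \<in> T" "T \<subseteq> U"
    using assms by (auto simp: nbhds_of_def interior_of_def)
  obtain S where S: "openin beta_omega S" "T = S \<inter> - range (\<lambda>n. principal {n})"
    using T(1) unfolding omega_star_def openin_subtopology by blast
  obtain A where A: "eventually (\<lambda>n. n \<in> A) p" "{G. ultrafilter G \<and> eventually (\<lambda>n. n \<in> A) G} \<subseteq> S"
    using openin_beta_omega_contains_basic[OF S(1)] T(2) S(2) by blast
  have "star A \<subseteq> T"
    using A(2) unfolding S(2) star_def omega_star_def topspace_subtopology topspace_beta_omega by blast
  then show thesis using that A(1) T(3) by blast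
qed

section \<open>No neighbourhood filter is cofinally equivalent to \<open>\<kappa> \<times> D\<close>\<close>

theorem lemma4p13:
  fixes n :: nat and \<kappa> :: "'k rel" and D :: "'d rel" and p :: "nat filter"
  assumes "1 \<le> n"
    and "Card_order \<kappa>" and "infinite (Field \<kappa>)" and "regularCard \<kappa>"
    and "\<kappa> <o m_sigma_n_linked n"
    and "Preorder D" and "\<kappa> <\<infinity> Add D"
    and "p \<in> topspace omega_star"
  shows "\<not> cofinally_equivalent TYPE('r) (Nbhd p omega_star) (prod_order \<kappa> D)"
proof
  let ?N = "nbhds_of p omega_star"
  let ?in_p = "\<lambda>A. eventually (\<lambda>m. m \<in> A) p"
  assume "cofinally_equivalent TYPE('r) (Nbhd p omega_star) (prod_order \<kappa> D)"
  then obtain R :: "'r rel" and f C g E where R: "Preorder R"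
    and f: "cofinal_subset C R" "iso_to_subset f (Nbhd p omega_star) C R"
    and g: "cofinal_subset E R" "iso_to_subset g (prod_order \<kappa> D) E R"
    unfolding cofinally_equivalent_def by blast
  have wo: "Well_order \<kappa>" using assms(2) by (rule card_order_on_well_order_on)
  have "Preorder \<kappa>" using wo by (simp add: order_on_defs)
  have ultra: "ultrafilter p" using assms(8) by (simp add: in_topspace_omega_star_iff)
  have R_trans: "(x, z) \<in> R" if "(x, y) \<in> R" "(y, z) \<in> R" for x y z
    using R that by (auto simp: preorder_on_def elim: transE)
  have R_refl: "(x, x) \<in> R" if "x \<in> Field R" for x
    using R that by (simp add: preorder_on_def refl_on_def)
  have D_refl: "(x, x) \<in> D" if "x \<in> Field D" for x
    using assms(6) that by (simp add: preorder_on_def refl_on_def)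
  have \<kappa>_refl: "(x, x) \<in> \<kappa>" if "x \<in> Field \<kappa>" for x
    using \<open>Preorder \<kappa>\<close> that by (simp add: preorder_on_def refl_on_def)
  have f_mem: "f U \<in> C" if "U \<in> ?N" for U
    using f(2) that by (auto simp: iso_to_subset_def bij_betw_def Field_Nbhd)
  have f_onto: "\<exists>U\<in>?N. x = f U" if "x \<in> C" for x
    using f(2) that by (auto simp: iso_to_subset_def bij_betw_def Field_Nbhd)
  have f_iff: "(f U, f V) \<in> R \<longleftrightarrow> V \<subseteq> U" if "U \<in> ?N" "V \<in> ?N" for U V
  proof -
    have "(f U, f V) \<in> R \<longleftrightarrow> (U, V) \<in> Nbhd p omega_star"
      using f(2) that unfolding iso_to_subset_def Field_Nbhd by blast
    then show ?thesis using that by (simp add: Nbhd_def)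
  qed
  have FP: "Field (prod_order \<kappa> D) = Field \<kappa> \<times> Field D"
    using \<open>Preorder \<kappa>\<close> assms(6) by (rule Field_prod_order)
  have g_mem: "g (\<alpha>, d) \<in> E" if "\<alpha> \<in> Field \<kappa>" "d \<in> Field D" for \<alpha> d
    using g(2) that by (auto simp: iso_to_subset_def bij_betw_def FP)
  have g_onto: "\<exists>\<alpha>\<in>Field \<kappa>. \<exists>d\<in>Field D. x = g (\<alpha>, d)" if "x \<in> E" for x
    using g(2) that by (auto simp: iso_to_subset_def bij_betw_def FP)
  have g_iff: "(g (\<alpha>, d), g (\<beta>, e)) \<in> R \<longleftrightarrow> (\<alpha>, \<beta>) \<in> \<kappa> \<and> (d, e) \<in> D"
    if "\<alpha> \<in> Field \<kappa>" "\<beta> \<in> Field \<kappa>" "d \<in> Field D" "e \<in> Field D" for \<alpha> \<beta> d e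
  proof -
    have "(g (\<alpha>, d), g (\<beta>, e)) \<in> R \<longleftrightarrow> ((\<alpha>, d), (\<beta>, e)) \<in> prod_order \<kappa> D"
      using g(2) that unfolding iso_to_subset_def FP by blast
    then show ?thesis by (simp add: prod_order_def)
  qed
  have CF: "C \<subseteq> Field R" "E \<subseteq> Field R" using f(1) g(1) by (auto simp: cofinal_subset_def)
  have below_g: "\<exists>\<alpha>\<in>Field \<kappa>. \<exists>d\<in>Field D. (x, g (\<alpha>, d)) \<in> R" if "x \<in> Field R" for x
    using g(1) that g_onto unfolding cofinal_subset_def by metis
  have below_f: "\<exists>A. ?in_p A \<and> (x, f (star A)) \<in> R" if x: "x \<in> Field R" for x
  proof -
    obtain U where U: "U \<in> ?N" "(x, f U) \<in> R"
      using f(1) x f_onto unfolding cofinal_subset_def by metis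
    obtain A where A: "?in_p A" "star A \<subseteq> U" using nbhds_of_contains_star[OF U(1)] .
    have "(f U, f (star A)) \<in> R" using f_iff[OF U(1) star_in_nbhds_of[OF assms(8) A(1)]] A(2) by simp
    then show ?thesis using A(1) U(2) R_trans by blast
  qed
  have D_bound: "\<exists>u\<in>Field D. \<forall>a\<in>A. (a, u) \<in> D" if "A \<subseteq> Field D" "|A| \<le>o \<kappa>" for A
    using assms(7) that less_Add_iff[OF assms(2)] by blast

  \<comment> \<open>The layers of \<open>p\<close> given by the first coordinate of \<open>\<kappa> \<times> D\<close>\<close>
  define L where "L \<alpha> = {A. ?in_p A \<and> (\<exists>d\<in>Field D. (f (star A), g (\<alpha>, d)) \<in> R)}" for \<alpha>
  have star_R: "f (star A) \<in> Field R" if "?in_p A" for A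
    using f_mem[OF star_in_nbhds_of[OF assms(8) that]] CF by blast
  have mono: "relChain \<kappa> L"
    unfolding relChain_def
  proof (intro allI impI subsetI)
    fix \<alpha> \<beta> A assume \<alpha>\<beta>: "(\<alpha>, \<beta>) \<in> \<kappa>" and "A \<in> L \<alpha>"
    then obtain d where d: "?in_p A" "d \<in> Field D" "(f (star A), g (\<alpha>, d)) \<in> R" by (auto simp: L_def)
    have "(g (\<alpha>, d), g (\<beta>, d)) \<in> R"
      using g_iff[OF FieldI1[OF \<alpha>\<beta>] FieldI2[OF \<alpha>\<beta>] d(2) d(2)] \<alpha>\<beta> D_refl d(2) by simp
    then show "A \<in> L \<beta>" using d R_trans unfolding L_def by blast
  qed
  have cover: "(\<Union>\<alpha>\<in>Field \<kappa>. L \<alpha>) = {A. ?in_p A}"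
  proof (intro equalityI subsetI)
    fix A assume "A \<in> {A. ?in_p A}"
    then show "A \<in> (\<Union>\<alpha>\<in>Field \<kappa>. L \<alpha>)" using below_g[OF star_R, of A] by (auto simp: L_def)
  qed (auto simp: L_def)
  have almost_subset: "finite (B - A)" if "?in_p A" "?in_p B" "(f (star A), f (star B)) \<in> R" for A B
    using that f_iff[OF star_in_nbhds_of star_in_nbhds_of, OF assms(8) that(1) assms(8) that(2)]
    by (simp add: star_subset_iff)
  have bounded: "\<exists>Y. ?in_p Y \<and> (\<forall>X\<in>\<X>. finite (Y - X))"
    if \<alpha>: "\<alpha> \<in> Field \<kappa>" and \<X>: "\<X> \<subseteq> L \<alpha>" "|\<X>| \<le>o \<kappa>" for \<alpha> \<X>
  proof -
    have "\<forall>X\<in>\<X>. \<exists>d\<in>Field D. (f (star X), g (\<alpha>, d)) \<in> R" using \<X>(1) by (auto simp: L_def)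
    then obtain d where d: "\<And>X. X \<in> \<X> \<Longrightarrow> d X \<in> Field D"
      "\<And>X. X \<in> \<X> \<Longrightarrow> (f (star X), g (\<alpha>, d X)) \<in> R" by metis
    have "|d ` \<X>| \<le>o \<kappa>" using card_of_image \<X>(2) by (rule ordLeq_transitive)
    then have "\<exists>u\<in>Field D. \<forall>a\<in>d ` \<X>. (a, u) \<in> D" using d(1) by (intro D_bound) auto
    then obtain u where u: "u \<in> Field D" "\<forall>X\<in>\<X>. (d X, u) \<in> D" by auto
    obtain Y where Y: "?in_p Y" "(g (\<alpha>, u), f (star Y)) \<in> R"
      using below_f[of "g (\<alpha>, u)"] g_mem[OF \<alpha> u(1)] CF by blast
    have "finite (Y - X)" if X: "X \<in> \<X>" for X
    proof (rule almost_subset)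
      show "?in_p X" using \<X>(1) X by (auto simp: L_def)
      have "(g (\<alpha>, d X), g (\<alpha>, u)) \<in> R"
        using g_iff[OF \<alpha> \<alpha> d(1)[OF X] u(1)] bspec[OF u(2) X] \<kappa>_refl[OF \<alpha>] by simp
      then show "(f (star X), f (star Y)) \<in> R" using d(2)[OF X] Y(2) R_trans by blast
    qed (rule Y(1))
    then show ?thesis using Y(1) by blast
  qed
  \<comment> \<open>A pseudo-intersection in \<open>p\<close> of the sets \<open>v \<delta>\<close> would lie below some \<open>(\<alpha>, d)\<close>, and \<open>\<alpha>\<close> would be
    the largest element of \<open>\<kappa>\<close>.\<close>
  obtain e where e: "e \<in> Field D" using D_bound[of "{}"] card_of_empty1 wo by blast
  have "\<forall>\<delta>\<in>Field \<kappa>. \<exists>A. ?in_p A \<and> (g (\<delta>, e), f (star A)) \<in> R"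
    using below_f g_mem[OF _ e] CF by blast
  then obtain v where v: "\<And>\<delta>. \<delta> \<in> Field \<kappa> \<Longrightarrow> ?in_p (v \<delta>)"
    "\<And>\<delta>. \<delta> \<in> Field \<kappa> \<Longrightarrow> (g (\<delta>, e), f (star (v \<delta>))) \<in> R" by metis
  have v_card: "|v ` Field \<kappa>| \<le>o \<kappa>"
    using card_of_image[of v "Field \<kappa>"] card_of_Field_ordIso[OF assms(2)] ordLeq_ordIso_trans by blast
  have v_in: "\<forall>V\<in>v ` Field \<kappa>. ?in_p V" using v(1) by blast
  have v_unbounded: "\<not> (\<exists>Y. ?in_p Y \<and> (\<forall>V\<in>v ` Field \<kappa>. finite (Y - V)))"
  proof
    assume "\<exists>Y. ?in_p Y \<and> (\<forall>V\<in>v ` Field \<kappa>. finite (Y - V))"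
    then obtain Y where Y: "?in_p Y" "\<forall>\<delta>\<in>Field \<kappa>. finite (Y - v \<delta>)" by auto
    obtain \<alpha> d where \<alpha>: "\<alpha> \<in> Field \<kappa>" "d \<in> Field D" "(f (star Y), g (\<alpha>, d)) \<in> R"
      using below_g[OF star_R[OF Y(1)]] by blast
    have max: "(\<delta>, \<alpha>) \<in> \<kappa>" if \<delta>: "\<delta> \<in> Field \<kappa>" for \<delta>
    proof -
      have "(f (star (v \<delta>)), f (star Y)) \<in> R"
        using f_iff[OF star_in_nbhds_of star_in_nbhds_of, OF assms(8) v(1)[OF \<delta>] assms(8) Y(1)]
          bspec[OF Y(2) \<delta>] by (simp add: star_subset_iff)
      then have "(g (\<delta>, e), g (\<alpha>, d)) \<in> R" using v(2)[OF \<delta>] \<alpha>(3) R_trans by blast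
      then show ?thesis using g_iff[OF \<delta> \<alpha>(1) e \<alpha>(2)] by simp
    qed
    obtain \<beta> where "\<beta> \<in> Field \<kappa>" "\<alpha> \<noteq> \<beta>" "(\<alpha>, \<beta>) \<in> \<kappa>"
      using infinite_Card_order_limit[OF assms(2,3) \<alpha>(1)] by blast
    then show False using max wo unfolding order_on_defs antisym_def by blast
  qed
  obtain B :: "'k \<Rightarrow> nat set" where B: "pairwise (\<lambda>\<xi> \<eta>. finite (B \<xi> \<inter> B \<eta>)) (Field \<kappa>)"
    "\<forall>X. ?in_p X \<longrightarrow> (\<exists>\<beta>\<in>Field \<kappa>. \<forall>\<xi>. (\<beta>, \<xi>) \<in> \<kappa> \<longrightarrow> infinite (X \<inter> B \<xi>))"
    using almost_disjoint_family_meeting_filter_sets[OF assms(2,4) mono cover bounded v_card v_in v_unbounded] .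
  show False using ultrafilter_set_almost_missing_cofinally_many[OF assms(1-3,5) ultra B(1)] B(2) by blast
qed

end
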